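(* Every planar graph $G$ contains a matching $M$ such that $\mathrm{AT}(G-M)\le 4$, where $G-M$ is the graph obtained from $G$ by deleting the edges of $M$ (keeping all vertices).
   Context: Graphs are finite and simple. A matching is a (possibly empty) set of pairwise vertex-disjoint edges. Fix a linear ordering $<$ of $V(G)$ and associate to each vertex $v$ of $G$ a variable $x_v$. The graph polynomial of $G$ is $$P_G(\mathtt{x})=\prod_{uv\in E(G),\,u<v}(x_v-x_u)\in\mathbb{R}[x_v : v\in V(G)].$$ For a map $\eta$ assigning to each vertex $v$ a non-negative integer $\eta(v)$, let $\mathtt{x}^{\eta}=\prod_{v}x_v^{\eta(v)}$ and let $c_{G,\eta}$ be the coefficient of $\mathtt{x}^{\eta}$ in the expansion of $P_G$ into monomials. The Alon-Tarsi number of $G$ is $$\mathrm{AT}(G)=\min\{k : c_{G,\eta}\ne 0 \text{ for some } \eta \text{ with } \eta(v)<k \text{ for all } v\in V(G)\}.$$ (Changing the linear ordering changes $P_G$ only by a sign, so $\mathrm{AT}(G)$ does not depend on it.) *)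

theory Defs
  imports "HOL-Analysis.Analysis" "HOL-Library.Poly_Mapping"
begin

definition simple_graph :: "'v set \<Rightarrow> 'v set set \<Rightarrow> bool" where
  "simple_graph V E \<longleftrightarrow> finite V \<and> (\<forall>e\<in>E. e \<subseteq> V \<and> card e = 2)"

definition matching :: "'v set set \<Rightarrow> 'v set set \<Rightarrow> bool" where
  "matching E M \<longleftrightarrow> M \<subseteq> E \<and> pairwise disjnt M"

(* A drawing places the vertices at distinct points and joins the ends of every edge by a
   Jordan arc; an arc meets vertex points only at its own ends, and two distinct arcs meet
   only at the points of vertices common to both edges. *)
definition plane_drawing ::
    "'v set \<Rightarrow> 'v set set \<Rightarrow> ('v \<Rightarrow> complex) \<Rightarrow> ('v set \<Rightarrow> real \<Rightarrow> complex) \<Rightarrow> bool" where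
  "plane_drawing V E p \<gamma> \<longleftrightarrow>
     inj_on p V \<and>
     (\<forall>e\<in>E. arc (\<gamma> e) \<and> {pathstart (\<gamma> e), pathfinish (\<gamma> e)} = p ` e) \<and>
     (\<forall>e\<in>E. path_image (\<gamma> e) \<inter> p ` V = p ` e) \<and>
     (\<forall>e\<in>E. \<forall>f\<in>E. e \<noteq> f \<longrightarrow> path_image (\<gamma> e) \<inter> path_image (\<gamma> f) = p ` (e \<inter> f))"

definition planar_graph :: "'v set \<Rightarrow> 'v set set \<Rightarrow> bool" where
  "planar_graph V E \<longleftrightarrow> simple_graph V E \<and> (\<exists>p \<gamma>. plane_drawing V E p \<gamma>)"

(* Exponent maps are of type 'v \<Rightarrow>\<^sub>0 nat, and polynomials are finitely supported maps from
   exponent maps to coefficients, with convolution as multiplication. *)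
type_synonym 'v rpoly = "('v \<Rightarrow>\<^sub>0 nat) \<Rightarrow>\<^sub>0 real"

definition pvar :: "'v \<Rightarrow> 'v rpoly" where
  "pvar v = Poly_Mapping.single (Poly_Mapping.single v 1) 1"

(* The linear ordering of the vertices is the reflexive relation r. *)
definition graph_poly :: "'v rel \<Rightarrow> 'v set set \<Rightarrow> 'v rpoly" where
  "graph_poly r E = (\<Prod>(u, v) \<in> {(u, v). {u, v} \<in> E \<and> (u, v) \<in> r \<and> u \<noteq> v}. pvar v - pvar u)"

definition AT_number :: "'v rel \<Rightarrow> 'v set \<Rightarrow> 'v set set \<Rightarrow> nat" where
  "AT_number r V E =
     (LEAST k. \<exists>\<eta>. Poly_Mapping.keys \<eta> \<subseteq> V \<and> Poly_Mapping.lookup (graph_poly r E) \<eta> \<noteq> 0 \<and>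
        (\<forall>v\<in>V. Poly_Mapping.lookup \<eta> v < k))"

end

theory Submission
  imports Defs
begin

text \<open>
  Vertices are peeled off from the outside. A connected set X of removed vertices plays the role of
  the outer face: the boundary of the remaining set U consists of the vertices of U with a
  neighbour in X. By induction one constructs a matching and a monomial of exponent at most 3 on U
  such that exponent plus matching degree is at most 2 on the boundary, while the at most two
  vertices of a precoloured boundary clique S have exponent 0 and are unmatched (edges inside S
  are disregarded). Cutting U along a clique of the boundary glues two solutions. When no such
  cut exists (and S has been enlarged to an edge if necessary), some boundary vertex z outside S has at most one boundary neighbour w outside S and
  at most two boundary neighbours in total. Moving z to X, either z can receive a factor from one
  of its edges besides those to S, or another non-vanishing monomial has smaller exponent at w and
  larger exponent at an interior neighbour i of z; in the latter case the edge zi is put into the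
  matching unless i is already matched.

  Planarity is used only through two forbidden minor-like configurations, of the types
  K(3,3) and K(5). Both are excluded by Janiszewski's theorem: a point y in the connected set
  drawn on one side of a Jordan curve J and a point w on the other side are separated by J, although J is
  covered by continua, meeting in continua, none of which separates y from w, because each of
  them misses a point of J that is accessible from both.
\<close>

subsection \<open>Connected vertex sets\<close>

text \<open>The numbers come from a budget. When z is put back, each neighbour of z outside S holds
  at most 2 and can afford one unit from the edge to z; it then reaches at most 3, which is allowed
  only off the old boundary. Edges from z to old boundary vertices must therefore be paid by z,
  whose own budget is 2; hence the limit of two boundary neighbours. Exponent 0 on S forces the
  choice on the edges to S, so these cannot cause cancellation. The neighbour w offers no such
  control, and the desired coefficient may vanish. But then some other term contributes, and
  comparing exponents shows that it moves one unit from w to a single i. Now w can pay for its own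
  edge, and z has a unit to spare, which buys the matching edge zi. If i is matched already, then
  its exponent was at most 1 and it can absorb two units. The connected set X takes over from the
  outer face so that no faces, triangulations or rotation systems occur: the topology only sees
  drawings of connected vertex sets.\<close>

definition adj_in :: "'v set set \<Rightarrow> 'v set \<Rightarrow> 'v rel" where
  "adj_in E A = {(x, y). x \<in> A \<and> y \<in> A \<and> {x, y} \<in> E}"

text \<open>The empty set counts as connected, so that the induction can start with X = {}.\<close>

definition conn :: "'v set set \<Rightarrow> 'v set \<Rightarrow> bool" where
  "conn E A \<longleftrightarrow> (\<forall>x\<in>A. \<forall>y\<in>A. (x, y) \<in> (adj_in E A)\<^sup>*)"

definition joined :: "'v set set \<Rightarrow> 'v set \<Rightarrow> 'v set \<Rightarrow> bool" where
  "joined E A B \<longleftrightarrow> (\<exists>a\<in>A. \<exists>b\<in>B. {a, b} \<in> E)"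

text \<open>For \<open>x\<close> outside \<open>A\<close> this is {x}, as reachability is
  reflexive.\<close>

definition component :: "'v set set \<Rightarrow> 'v set \<Rightarrow> 'v \<Rightarrow> 'v set" where
  "component E A x = {y. (x, y) \<in> (adj_in E A)\<^sup>*}"

lemma joined_sym: "joined E A B \<longleftrightarrow> joined E B A"
  unfolding joined_def by (metis insert_commute)

lemma joined_mono: "joined E A B \<Longrightarrow> A \<subseteq> A' \<Longrightarrow> B \<subseteq> B' \<Longrightarrow> joined E A' B'"
  unfolding joined_def by blast

lemma adj_in_mono: "A \<subseteq> B \<Longrightarrow> adj_in E A \<subseteq> adj_in E B"
  unfolding adj_in_def by blast

lemma sym_adj_in: "sym (adj_in E A)"
  unfolding adj_in_def sym_def by (auto simp: insert_commute)

lemma adj_in_rtrancl_sym: "(x, y) \<in> (adj_in E A)\<^sup>* \<Longrightarrow> (y, x) \<in> (adj_in E A)\<^sup>*"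
  using sym_rtrancl[OF sym_adj_in] by (metis symD)

lemma conn_empty [simp]: "conn E {}" and conn_singleton [simp]: "conn E {x}"
  unfolding conn_def by auto

lemma conn_edge: "{x, y} \<in> E \<Longrightarrow> conn E {x, y}"
  unfolding conn_def adj_in_def by (auto simp: insert_commute)

lemma conn_Un:
  assumes A: "conn E A" and B: "conn E B" and AB: "A \<inter> B \<noteq> {} \<or> joined E A B"
  shows "conn E (A \<union> B)"
proof -
  let ?R = "(adj_in E (A \<union> B))\<^sup>*"
  have in_A: "(x, y) \<in> ?R" if "x \<in> A" "y \<in> A" for x y
    using A that rtrancl_mono[OF adj_in_mono[of A "A \<union> B" E]] unfolding conn_def by blast
  have in_B: "(x, y) \<in> ?R" if "x \<in> B" "y \<in> B" for x y
    using B that rtrancl_mono[OF adj_in_mono[of B "A \<union> B" E]] unfolding conn_def by blast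
  obtain a b where ab: "a \<in> A" "b \<in> B" "(a, b) \<in> ?R"
    using AB unfolding joined_def adj_in_def by blast
  have AB': "(x, y) \<in> ?R" if "x \<in> A" "y \<in> B" for x y
    using in_A[OF that(1) ab(1)] ab(3) in_B[OF ab(2) that(2)] by (meson rtrancl_trans)
  show ?thesis
    unfolding conn_def using in_A in_B AB' adj_in_rtrancl_sym by (metis Un_iff)
qed

lemma conn_insert: "conn E A \<Longrightarrow> joined E {x} A \<Longrightarrow> conn E (insert x A)"
  using conn_Un[of E "{x}" A] by simp

text \<open>Used in place of paths: a property that passes along the edges inside a connected set
  spreads from one vertex to all of them.\<close>

lemma conn_closed:
  assumes "conn E A" "x \<in> A" "x \<in> W" and W: "\<And>u v. u \<in> W \<Longrightarrow> u \<in> A \<Longrightarrow> v \<in> A \<Longrightarrow> {u, v} \<in> E \<Longrightarrow> v \<in> W"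
  shows "A \<subseteq> W"
proof
  fix y assume "y \<in> A"
  then have "(x, y) \<in> (adj_in E A)\<^sup>*" using assms unfolding conn_def by blast
  then show "y \<in> W"
    by induction (use \<open>x \<in> W\<close> W in \<open>auto simp: adj_in_def\<close>)
qed

lemma component_self [simp]: "x \<in> component E A x"
  unfolding component_def by simp

lemma component_subset:
  assumes "x \<in> A" shows "component E A x \<subseteq> A"
proof
  fix y assume "y \<in> component E A x"
  then have "(x, y) \<in> (adj_in E A)\<^sup>*" unfolding component_def by simp
  then show "y \<in> A" by induction (use assms in \<open>auto simp: adj_in_def\<close>)
qed

lemma component_closed: "y \<in> component E A x \<Longrightarrow> y \<in> A \<Longrightarrow> z \<in> A \<Longrightarrow> {y, z} \<in> E \<Longrightarrow> z \<in> component E A x"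
  unfolding component_def adj_in_def
  by (smt (verit) case_prodI mem_Collect_eq rtrancl.rtrancl_into_rtrancl)

lemma component_eq: "y \<in> component E A x \<Longrightarrow> component E A y = component E A x"
  unfolding component_def using adj_in_rtrancl_sym[of _ _ E A] by (auto intro: rtrancl_trans)

lemma component_disjoint: "component E A x \<noteq> component E A y \<Longrightarrow> component E A x \<inter> component E A y = {}"
  by (metis component_eq disjoint_iff)

lemma conn_component:
  assumes "x \<in> A" shows "conn E (component E A x)"
proof -
  let ?C = "component E A x"
  have "(x, y) \<in> (adj_in E ?C)\<^sup>*" if "(x, y) \<in> (adj_in E A)\<^sup>*" for y
    using that
  proof induction
    case (step y z)
    then have "y \<in> ?C" "z \<in> ?C" "{y, z} \<in> E"
      unfolding component_def by (auto simp: adj_in_def intro: rtrancl_into_rtrancl)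
    then have "(y, z) \<in> adj_in E ?C" unfolding adj_in_def by simp
    then show ?case using step.IH by (meson rtrancl.rtrancl_into_rtrancl)
  qed simp
  then have "(x, y) \<in> (adj_in E ?C)\<^sup>*" if "y \<in> ?C" for y
    using that unfolding component_def by simp
  then show ?thesis
    unfolding conn_def by (meson adj_in_rtrancl_sym rtrancl_trans)
qed

text \<open>The inner vertices of a path from \<open>a\<close> to \<open>b\<close> lie in one
  component of A - {a, b}, unless the path is an edge. Without paths: if both alternatives failed,
  \<open>a\<close> together with the components attached to \<open>a\<close> would be closed under
  the edges of \<open>A\<close> and would miss \<open>b\<close>.\<close>

lemma conn_path_block:
  assumes A: "conn E A" and ab: "a \<in> A" "b \<in> A" "a \<noteq> b"
  obtains "{a, b} \<in> E"
  | t where "t \<in> A - {a, b}" "joined E {a} (component E (A - {a, b}) t)" "joined E {b} (component E (A - {a, b}) t)"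
proof (rule ccontr)
  let ?R = "A - {a, b}"
  assume "\<not> thesis"
  then have nE: "{a, b} \<notin> E"
    and nT: "\<And>t. t \<in> ?R \<Longrightarrow> joined E {a} (component E ?R t) \<Longrightarrow> \<not> joined E {b} (component E ?R t)"
    using that by auto
  define W where "W = insert a {t \<in> ?R. joined E {a} (component E ?R t)}"
  have "A \<subseteq> W"
  proof (rule conn_closed[OF A \<open>a \<in> A\<close>])
    fix u v assume u: "u \<in> W" "u \<in> A" and v: "v \<in> A" "{u, v} \<in> E"
    show "v \<in> W"
    proof (cases "u = a")
      case True
      then have "v \<noteq> b" using nE v by auto
      then show ?thesis
        using True v component_self[of v E ?R] unfolding W_def joined_def by auto
    next
      case False
      then have u': "u \<in> ?R" "joined E {a} (component E ?R u)" using u unfolding W_def by auto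
      have "v \<noteq> b"
      proof
        assume "v = b"
        then have "{b, u} \<in> E" using v by (simp add: insert_commute)
        then have "joined E {b} (component E ?R u)" unfolding joined_def by (meson component_self singletonI)
        then show False using nT[OF u'] by simp
      qed
      moreover have "component E ?R v = component E ?R u" if "v \<noteq> a" "v \<noteq> b"
        by (rule component_eq, rule component_closed[of u]) (use that u' v in auto)
      ultimately show ?thesis using u' v unfolding W_def by auto
    qed
  qed (simp add: W_def)
  then show False using ab unfolding W_def by auto
qed

lemma conn_segment:
  assumes "i \<le> j" "\<And>m. i \<le> m \<Longrightarrow> m < j \<Longrightarrow> {f m, f (Suc m)} \<in> E"
  shows "conn E (f ` {i..j::nat})"
  using assms
proof (induction rule: dec_induct)
  case (step n)
  have "conn E (insert (f (Suc n)) (f ` {i..n}))"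
    using step by (intro conn_insert) (auto simp: joined_def insert_commute intro!: bexI[of _ n])
  then show ?case using step by (simp add: atLeastAtMostSuc_conv)
qed simp

definition boundary :: "'v set set \<Rightarrow> 'v set \<Rightarrow> 'v set \<Rightarrow> 'v set" where
  "boundary E U X = {v \<in> U. joined E {v} X}"

definition nbrs :: "'v set set \<Rightarrow> 'v \<Rightarrow> 'v set" where
  "nbrs E z = {u. {z, u} \<in> E}"

subsection \<open>Continua in the plane\<close>

lemma connected_meets_Int:
  assumes "connected S" "closed F" "closed G" "S \<subseteq> F \<union> G" "S \<inter> F \<noteq> {}" "S \<inter> G \<noteq> {}"
  shows "S \<inter> (F \<inter> G) \<noteq> {}"
  using connected_closedD[of S F G] assms by blast

lemma connected_Un_family:
  assumes "connected S" "\<And>T. T \<in> \<T> \<Longrightarrow> connected T \<and> T \<inter> S \<noteq> {}" "S \<noteq> {}"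
  shows "connected (S \<union> \<Union>\<T>)"
proof -
  have "connected (\<Union>(insert S ((\<lambda>T. S \<union> T) ` \<T>)))"
  proof (rule connected_Union)
    show "\<And>s. s \<in> insert S ((\<union>) S ` \<T>) \<Longrightarrow> connected s"
      using assms by (auto intro!: connected_Un)
    show "\<Inter> (insert S ((\<union>) S ` \<T>)) \<noteq> {}" using assms(3) by blast
  qed
  moreover have "\<Union>(insert S ((\<lambda>T. S \<union> T) ` \<T>)) = S \<union> \<Union>\<T>" by blast
  ultimately show ?thesis by simp
qed

text \<open>Makes vertex points accessible: an end of an arc is a limit of the remaining half-open
  arc, which is still connected.\<close>

lemma arc_minus_start:
  assumes "arc g"
  shows "connected (path_image g - {pathstart g})" "pathstart g \<in> closure (path_image g - {pathstart g})"
proof -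
  have cont: "continuous_on {0..1} g" and inj: "inj_on g {0..1}"
    using assms by (auto simp: arc_def path_def)
  have eq: "path_image g - {pathstart g} = g ` {0<..1}"
  proof -
    have "g ` ({0..1} - {0}) = g ` {0..1} - g ` {0}"
      by (rule inj_on_image_set_diff[OF inj]) auto
    moreover have "{0..1} - {0} = {0<..1::real}" by auto
    ultimately show ?thesis unfolding path_image_def pathstart_def by simp
  qed
  show "connected (path_image g - {pathstart g})"
    unfolding eq by (rule connected_continuous_image[OF continuous_on_subset[OF cont]]) auto
  have "g ` closure {0<..1} \<subseteq> closure (g ` {0<..1})"
    by (rule image_closure_subset) (use cont closure_subset[of "g ` {0<..1}"] in auto)
  then show "pathstart g \<in> closure (path_image g - {pathstart g})"
    unfolding eq by (auto simp: pathstart_def)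
qed

lemma arc_minus_end:
  assumes "arc g" "z = pathstart g \<or> z = pathfinish g"
  shows "connected (path_image g - {z})" "z \<in> closure (path_image g - {z})"
  using arc_minus_start[OF assms(1)] arc_minus_start[OF arc_reversepath[OF assms(1)]] assms(2) by auto

text \<open>Take \<open>v\<close> as the first time in \<open>B\<close>, then \<open>u\<close> as
  the last time before \<open>v\<close> in \<open>A\<close>; both exist because the sets of times
  are compact.\<close>

lemma path_crossing_segment:
  fixes g :: "real \<Rightarrow> 'a::t2_space"
  assumes g: "path g" and cl: "closed A" "closed B" "A \<inter> B = {}" and st: "pathstart g \<in> A" "pathfinish g \<in> B"
  obtains u v where "0 \<le> u" "u < v" "v \<le> 1" "g u \<in> A" "g v \<in> B" "g ` {u<..<v} \<inter> (A \<union> B) = {}"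
proof -
  have cont: "continuous_on {0..1} g" using g by (simp add: path_def)
  have cpt: "compact {t\<in>{0..c}. g t \<in> F}" if "closed F" "c \<le> 1" for F c
  proof -
    have "continuous_on {0..c} g" using cont that(2) by (auto intro: continuous_on_subset)
    then have "closed ({0..c} \<inter> g -` F)" using that(1) by (simp add: continuous_on_closed_vimage Int_commute)
    moreover have "{t\<in>{0..c}. g t \<in> F} = {0..c} \<inter> ({0..c} \<inter> g -` F)" by auto
    ultimately show ?thesis by (metis compact_Icc compact_Int_closed)
  qed
  have "{t\<in>{0..1}. g t \<in> B} \<noteq> {}" using st(2) by (auto simp: pathfinish_def intro!: exI[of _ 1])
  then obtain v where v: "v \<in> {0..1}" "g v \<in> B" "\<And>t. t \<in> {0..1} \<Longrightarrow> g t \<in> B \<Longrightarrow> v \<le> t"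
    using compact_attains_inf[OF cpt[OF cl(2), of 1]] by auto
  have "{t\<in>{0..v}. g t \<in> A} \<noteq> {}" using st(1) v(1) by (auto simp: pathstart_def intro!: exI[of _ 0])
  then obtain u where u: "u \<in> {0..v}" "g u \<in> A" "\<And>t. t \<in> {0..v} \<Longrightarrow> g t \<in> A \<Longrightarrow> t \<le> u"
    using compact_attains_sup[OF cpt[OF cl(1), of v]] v(1) by auto
  have "u \<noteq> v" using u(2) v(2) cl(3) by auto
  then have "u < v" using u(1) by simp
  have "g t \<notin> A \<union> B" if "u < t" "t < v" for t
    using u(1) u(3)[of t] v(1) v(3)[of t] that by force
  then have "g ` {u<..<v} \<inter> (A \<union> B) = {}" by auto
  then show ?thesis using that[of u v] u v \<open>u < v\<close> by auto
qed

lemma arc_in_path_connected: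
  fixes S :: "complex set"
  assumes "path_connected S" "x \<in> S" "y \<in> S" "x \<noteq> y"
  obtains g where "arc g" "path_image g \<subseteq> S" "pathstart g = x" "pathfinish g = y"
  using assms path_connected_arcwise[of S] by blast

text \<open>A connected set off the curve lies inside or outside; \<open>W\<close> is the other one
  of the two. Since each side has the whole curve as its frontier, every point of the curve is
  accessible from \<open>W\<close>.\<close>

lemma Jordan_other_side:
  fixes c :: "real \<Rightarrow> complex"
  assumes c: "simple_path c" "pathfinish c = pathstart c"
    and Y: "connected Y" "Y \<inter> path_image c = {}"
  obtains W where "W \<noteq> {}" "connected W" "W \<inter> path_image c = {}" "path_image c \<subseteq> closure W" "W \<inter> Y = {}"
    "\<And>w y. w \<in> W \<Longrightarrow> y \<in> Y \<Longrightarrow> \<not> connected_component (- path_image c) y w"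
proof -
  define I where "I = inside (path_image c)"
  define O' where "O' = outside (path_image c)"
  have J: "I \<noteq> {}" "open I" "connected I" "O' \<noteq> {}" "open O'" "connected O'" "I \<inter> O' = {}"
    "I \<union> O' = - path_image c" "frontier I = path_image c" "frontier O' = path_image c"
    using Jordan_inside_outside[OF c] unfolding I_def O'_def by blast+
  have split: "T \<inter> I = {} \<or> T \<inter> O' = {}" if "connected T" "T \<subseteq> - path_image c" for T
    using connectedD[of T I O'] J that by blast
  have sep: "\<not> connected_component (- path_image c) y w" if yw: "y \<in> I \<and> w \<in> O' \<or> y \<in> O' \<and> w \<in> I" for y w
  proof
    assume "connected_component (- path_image c) y w"
    then obtain T where "connected T" "T \<subseteq> - path_image c" "y \<in> T" "w \<in> T"
      unfolding connected_component_def by blast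
    then show False using split[of T] yw by blast
  qed
  have cover: "Y \<subseteq> I \<union> O'" using J(8) Y(2) by blast
  have cl: "path_image c \<subseteq> closure I" "path_image c \<subseteq> closure O'"
    using J(9,10) by (auto simp: frontier_def)
  have dis: "I \<inter> path_image c = {}" "O' \<inter> path_image c = {}" using J(8) by blast+
  show ?thesis
  proof (cases "Y \<inter> I = {}")
    case True
    then have "Y \<subseteq> O'" using cover by blast
    then have "\<not> connected_component (- path_image c) y w" if "w \<in> I" "y \<in> Y" for w y
      using sep that by blast
    then show ?thesis using that[OF J(1,3) dis(1) cl(1)] True by blast
  next
    case False
    then have Y': "Y \<inter> O' = {}" using split[of Y] Y by blast
    then have "Y \<subseteq> I" using cover by blast
    then have "\<not> connected_component (- path_image c) y w" if "w \<in> O'" "y \<in> Y" for w y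
      using sep that by blast
    then show ?thesis using that[OF J(4,6) dis(2) cl(2)] Y' by blast
  qed
qed

text \<open>Adding a closure point keeps a set connected, so \<open>q\<close> links \<open>W\<close>
  with \<open>Y\<close>. Accessibility thus means membership in a closure; no arc ending at
  \<open>q\<close> has to be constructed.\<close>

lemma connected_component_via_closure_point:
  assumes "connected W" "connected Y" "w \<in> W" "y \<in> Y" "q \<in> closure W" "q \<in> closure Y"
    "S \<inter> W = {}" "S \<inter> Y = {}" "q \<notin> S"
  shows "connected_component (- S) y w"
proof (rule connected_componentI)
  have "insert q W \<subseteq> closure W" "insert q Y \<subseteq> closure Y"
    using assms closure_subset by auto
  then have "connected (insert q W)" "connected (insert q Y)"
    using assms(1,2) connected_intermediate_closure[of W "insert q W"] connected_intermediate_closure[of Y "insert q Y"]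
    by auto
  then show "connected (insert q W \<union> insert q Y)" by (rule connected_Un) auto
qed (use assms in auto)

subsection \<open>Forbidden configurations in a plane drawing\<close>

locale drawing =
  fixes V :: "'v set" and E :: "'v set set" and p :: "'v \<Rightarrow> complex" and \<gamma> :: "'v set \<Rightarrow> real \<Rightarrow> complex"
  assumes simple: "simple_graph V E" and plane: "plane_drawing V E p \<gamma>"
begin

section \<open>Drawings of induced subgraphs\<close>

lemma finite_V: "finite V" and edge_subset: "e \<in> E \<Longrightarrow> e \<subseteq> V" and edge_card: "e \<in> E \<Longrightarrow> card e = 2"
  using simple unfolding simple_graph_def by auto

lemma finite_E: "finite E"
  using finite_V edge_subset by (meson Sup_le_iff finite_Pow_iff PowI finite_subset subsetI)

lemma inj_p: "inj_on p V" and arc_edge: "e \<in> E \<Longrightarrow> arc (\<gamma> e)"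
  and ends_edge: "e \<in> E \<Longrightarrow> {pathstart (\<gamma> e), pathfinish (\<gamma> e)} = p ` e"
  and edge_vertices: "e \<in> E \<Longrightarrow> path_image (\<gamma> e) \<inter> p ` V = p ` e"
  and edge_edge: "e \<in> E \<Longrightarrow> f \<in> E \<Longrightarrow> e \<noteq> f \<Longrightarrow> path_image (\<gamma> e) \<inter> path_image (\<gamma> f) = p ` (e \<inter> f)"
  using plane unfolding plane_drawing_def by auto

text \<open>Edges inside \<open>A\<close> are all included, since for induced subgraphs the
  intersection of two drawings is again of this kind.\<close>

definition drawn :: "'v set \<Rightarrow> complex set" where
  "drawn A = p ` A \<union> (\<Union>e\<in>{e \<in> E. e \<subseteq> A}. path_image (\<gamma> e))"

lemma drawn_mono: "A \<subseteq> B \<Longrightarrow> drawn A \<subseteq> drawn B"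
  unfolding drawn_def by blast

lemma p_in_drawn: "x \<in> A \<Longrightarrow> p x \<in> drawn A"
  unfolding drawn_def by blast

lemma drawn_empty [simp]: "drawn {} = {}" and drawn_singleton [simp]: "drawn {x} = {p x}"
proof -
  have no: "\<not> e \<subseteq> {x}" if "e \<in> E" for e
    using edge_card[OF that] card_mono[of "{x}" e] by auto
  then have *: "{e \<in> E. e \<subseteq> {}} = {}" "{e \<in> E. e \<subseteq> {x}} = {}" by auto
  show "drawn {} = {}" "drawn {x} = {p x}" unfolding drawn_def * by simp_all
qed

lemma drawn_eq_empty [simp]: "drawn A = {} \<longleftrightarrow> A = {}"
  using p_in_drawn by fastforce

lemma compact_drawn: assumes "A \<subseteq> V" shows "compact (drawn A)"
proof -
  have "finite A" using assms finite_V finite_subset by blast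
  moreover have "compact (\<Union>e\<in>{e \<in> E. e \<subseteq> A}. path_image (\<gamma> e))"
    by (rule compact_UN) (use finite_E in \<open>auto intro: compact_arc_image arc_edge\<close>)
  ultimately show ?thesis unfolding drawn_def by (simp add: compact_Un finite_imp_compact)
qed

lemma closed_drawn: "A \<subseteq> V \<Longrightarrow> closed (drawn A)"
  by (simp add: compact_drawn compact_imp_closed)

text \<open>That distinct edges meet only at common ends is used here and nowhere else; later
  disjointness claims reduce to set algebra on vertices. An edge drawn in both has its ends in both
  sets, and a vertex point on an edge is an end of that edge.\<close>

lemma drawn_Int: assumes "A \<subseteq> V" "B \<subseteq> V" shows "drawn A \<inter> drawn B = drawn (A \<inter> B)"
proof
  show "drawn (A \<inter> B) \<subseteq> drawn A \<inter> drawn B" by (simp add: drawn_mono)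
  have vv: "x \<in> p ` (A \<inter> B)" if "x \<in> p ` A" "x \<in> p ` B" for x
    using that inj_on_image_Int[OF inj_p assms] by auto
  have ve: "x \<in> p ` (F \<inter> G)" if "x \<in> p ` F" "e \<in> E" "e \<subseteq> G" "x \<in> path_image (\<gamma> e)" "F \<subseteq> V" "G \<subseteq> V" for x e F G
  proof -
    have "x \<in> p ` e" using edge_vertices[OF that(2)] that by blast
    then have "x \<in> p ` (F \<inter> e)" using that edge_subset[OF that(2)] inj_on_image_Int[OF inj_p, of F e] by auto
    then show ?thesis using that by auto
  qed
  have ee: "x \<in> drawn (A \<inter> B)" if "e \<in> E" "f \<in> E" "e \<subseteq> A" "f \<subseteq> B" "x \<in> path_image (\<gamma> e)" "x \<in> path_image (\<gamma> f)" for x e f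
  proof (cases "e = f")
    case False
    then have "x \<in> p ` (e \<inter> f)" using that edge_edge by blast
    then show ?thesis using that unfolding drawn_def by blast
  qed (use that in \<open>auto simp: drawn_def\<close>)
  show "drawn A \<inter> drawn B \<subseteq> drawn (A \<inter> B)"
  proof
    fix x assume "x \<in> drawn A \<inter> drawn B"
    then consider "x \<in> p ` A" "x \<in> p ` B" | e where "x \<in> p ` A" "e \<in> E" "e \<subseteq> B" "x \<in> path_image (\<gamma> e)"
      | e where "x \<in> p ` B" "e \<in> E" "e \<subseteq> A" "x \<in> path_image (\<gamma> e)"
      | e f where "e \<in> E" "f \<in> E" "e \<subseteq> A" "f \<subseteq> B" "x \<in> path_image (\<gamma> e)" "x \<in> path_image (\<gamma> f)"
      unfolding drawn_def by blast
    then show "x \<in> drawn (A \<inter> B)"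
    proof cases
      case 1 then show ?thesis using vv drawn_def by blast
    next
      case 2 then show ?thesis using ve[of x A e B] assms drawn_def by blast
    next
      case 3 then show ?thesis using ve[of x B e A] assms drawn_def by (metis Int_commute UnI1)
    next
      case 4 then show ?thesis using ee by blast
    qed
  qed
qed

lemma path_connected_drawn:
  assumes A: "conn E A"
  shows "path_connected (drawn A)"
proof -
  have edge: "path_component (drawn A) x y" if "e \<in> E" "e \<subseteq> A" "x \<in> path_image (\<gamma> e)" "y \<in> path_image (\<gamma> e)" for e x y
  proof -
    have "path_connected (path_image (\<gamma> e))"
      using arc_imp_path[OF arc_edge[OF that(1)]] by (rule path_connected_path_image)
    moreover have "path_image (\<gamma> e) \<subseteq> drawn A" using that unfolding drawn_def by blast
    ultimately show ?thesis using that by (meson path_component_of_subset path_connected_component)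
  qed
  have end_in: "p u \<in> path_image (\<gamma> e)" if "e \<in> E" "u \<in> e" for e u
    using ends_edge[OF that(1)] that(2) by (metis image_eqI insert_iff pathfinish_in_path_image pathstart_in_path_image singletonD)
  have vert: "path_component (drawn A) (p u) (p v)" if "u \<in> A" "(u, v) \<in> (adj_in E A)\<^sup>*" for u v
    using that(2)
  proof induction
    case base then show ?case using that(1) p_in_drawn by (simp add: path_component_refl)
  next
    case (step v w)
    then have "path_component (drawn A) (p v) (p w)"
      by (intro edge[of "{v, w}"] end_in) (auto simp: adj_in_def)
    then show ?case using step.IH path_component_trans by blast
  qed
  have rep: "\<exists>u\<in>A. path_component (drawn A) x (p u)" if x: "x \<in> drawn A" for x
  proof (cases "x \<in> p ` A")
    case True then show ?thesis using x path_component_refl[OF x] by auto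
  next
    case False
    then obtain e where e: "e \<in> E" "e \<subseteq> A" "x \<in> path_image (\<gamma> e)" using x unfolding drawn_def by blast
    then obtain u where "u \<in> e" using edge_card[OF e(1)] by fastforce
    then show ?thesis using edge[OF e(1,2,3) end_in] e by blast
  qed
  show ?thesis
    unfolding path_connected_component
  proof (intro ballI)
    fix x y assume "x \<in> drawn A" "y \<in> drawn A"
    then obtain u v where "u \<in> A" "v \<in> A" "path_component (drawn A) x (p u)" "path_component (drawn A) y (p v)"
      using rep by metis
    then show "path_component (drawn A) x y"
      using vert A unfolding conn_def by (meson path_component_sym path_component_trans)
  qed
qed

lemma connected_drawn: "conn E A \<Longrightarrow> connected (drawn A)"
  by (simp add: path_connected_drawn path_connected_imp_connected)

text \<open>Every edge drawn at \<open>a\<close> has its other end in \<open>X\<close>. So removing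
  \<open>p a\<close> leaves \<open>drawn X\<close> with half-open arcs attached, and
  \<open>p a\<close> is a limit of each of these.\<close>

lemma drawn_insert_minus:
  assumes X: "conn E X" "insert a X \<subseteq> V" "a \<notin> X" and aX: "joined E {a} X"
  shows "connected (drawn (insert a X) - {p a})" "p a \<in> closure (drawn (insert a X) - {p a})"
    "drawn X \<subseteq> drawn (insert a X) - {p a}"
proof -
  let ?\<T> = "{path_image (\<gamma> e) - {p a} | e. e \<in> E \<and> e \<subseteq> insert a X \<and> a \<in> e}"
  have "drawn X \<inter> drawn {a} = {}" using X drawn_Int[of X "{a}"] by auto
  then have paX: "p a \<notin> drawn X" by simp
  then show sub: "drawn X \<subseteq> drawn (insert a X) - {p a}" using drawn_mono[of X "insert a X"] by blast
  have eq: "drawn (insert a X) - {p a} = drawn X \<union> \<Union>?\<T>"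
  proof
    show "drawn (insert a X) - {p a} \<subseteq> drawn X \<union> \<Union>?\<T>"
    proof
      fix x assume x: "x \<in> drawn (insert a X) - {p a}"
      then consider "x \<in> p ` X" | e where "e \<in> E" "e \<subseteq> insert a X" "x \<in> path_image (\<gamma> e)"
        unfolding drawn_def by blast
      then show "x \<in> drawn X \<union> \<Union>?\<T>"
      proof cases
        case 1 then show ?thesis unfolding drawn_def by blast
      next
        case 2
        show ?thesis
        proof (cases "a \<in> e")
          case False
          then have "e \<subseteq> X" using 2 by blast
          then show ?thesis using 2 unfolding drawn_def by blast
        qed (use 2 x in blast)
      qed
    qed
    show "drawn X \<union> \<Union>?\<T> \<subseteq> drawn (insert a X) - {p a}"
      using sub unfolding drawn_def by blast
  qed
  have edge: "connected (path_image (\<gamma> e) - {p a}) \<and> p a \<in> closure (path_image (\<gamma> e) - {p a})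
     \<and> (path_image (\<gamma> e) - {p a}) \<inter> drawn X \<noteq> {}" if e: "e \<in> E" "e \<subseteq> insert a X" "a \<in> e" for e
  proof -
    have "p a = pathstart (\<gamma> e) \<or> p a = pathfinish (\<gamma> e)" using ends_edge[OF e(1)] e(3) by blast
    note * = arc_minus_end[OF arc_edge[OF e(1)] this]
    have "card e = 2" using e edge_card by blast
    then obtain x where "x \<in> e" "x \<noteq> a" using e(3) by (metis card_2_iff' )
    then have "x \<in> X" using e by blast
    then have "p x \<in> drawn X" by (rule p_in_drawn)
    moreover have "p x \<in> path_image (\<gamma> e)" using edge_vertices[OF e(1)] \<open>x \<in> e\<close> by blast
    ultimately show ?thesis using * paX by auto
  qed
  have "drawn X \<noteq> {}" using aX unfolding joined_def by auto
  then show "connected (drawn (insert a X) - {p a})"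
    unfolding eq by (intro connected_Un_family) (use edge connected_drawn X in blast)+
  obtain x where x: "x \<in> X" "{a, x} \<in> E" using aX unfolding joined_def by auto
  then have "p a \<in> closure (path_image (\<gamma> {a, x}) - {p a})" using edge[of "{a, x}"] by blast
  moreover have "path_image (\<gamma> {a, x}) - {p a} \<subseteq> drawn (insert a X) - {p a}"
    unfolding eq using x by blast
  ultimately show "p a \<in> closure (drawn (insert a X) - {p a})" using closure_mono by blast
qed

text \<open>Two separate drawings are united so that a possible edge from \<open>a\<close> to
  \<open>b\<close> is left out. The arc has to change from one drawing to the other, and they
  overlap exactly in \<open>drawn Z\<close>.\<close>

lemma bridge_arc:
  assumes Z: "conn E Z" "insert a (insert b Z) \<subseteq> V" "a \<notin> Z" "b \<notin> Z" "a \<noteq> b" "joined E {a} Z" "joined E {b} Z"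
  obtains g where "arc g" "pathstart g = p a" "pathfinish g = p b"
    "path_image g \<subseteq> drawn (insert a Z) \<union> drawn (insert b Z)" "path_image g \<inter> drawn Z \<noteq> {}"
proof -
  have V: "insert a Z \<subseteq> V" "insert b Z \<subseteq> V" using Z by auto
  have "insert a Z \<inter> insert b Z = Z" using Z by auto
  then have I: "drawn (insert a Z) \<inter> drawn (insert b Z) = drawn Z" using drawn_Int[OF V] by simp
  have "Z \<noteq> {}" using Z unfolding joined_def by blast
  then have "path_connected (drawn (insert a Z) \<union> drawn (insert b Z))"
    by (intro path_connected_Un path_connected_drawn conn_insert) (use Z I in auto)
  moreover have "p a \<noteq> p b" using inj_onD[OF inj_p] Z by auto
  ultimately obtain g where g: "arc g" "path_image g \<subseteq> drawn (insert a Z) \<union> drawn (insert b Z)"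
    "pathstart g = p a" "pathfinish g = p b"
    using arc_in_path_connected[of "drawn (insert a Z) \<union> drawn (insert b Z)" "p a" "p b"] p_in_drawn by blast
  have "path_image g \<inter> (drawn (insert a Z) \<inter> drawn (insert b Z)) \<noteq> {}"
  proof (rule connected_meets_Int)
    show "connected (path_image g)" using g(1) by (simp add: connected_arc_image)
    have "p a \<in> path_image g" "p b \<in> path_image g" using g by (metis pathstart_in_path_image pathfinish_in_path_image)+
    moreover have "p a \<in> drawn (insert a Z)" "p b \<in> drawn (insert b Z)" by (auto intro: p_in_drawn)
    ultimately show "path_image g \<inter> drawn (insert a Z) \<noteq> {}" "path_image g \<inter> drawn (insert b Z) \<noteq> {}" by blast+
  qed (use g V closed_drawn in auto)
  then show ?thesis using that g I by auto
qed

section \<open>Exclusion of the two configurations by Janiszewski's theorem\<close>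

lemma drawn_Int_subset: "A \<subseteq> V \<Longrightarrow> B \<subseteq> V \<Longrightarrow> A \<inter> B \<subseteq> C \<Longrightarrow> drawn A \<inter> drawn B \<subseteq> drawn C"
  using drawn_Int drawn_mono by metis

lemma drawn_disjoint: "A \<subseteq> V \<Longrightarrow> B \<subseteq> V \<Longrightarrow> A \<inter> B = {} \<Longrightarrow> drawn A \<inter> drawn B = {}"
  using drawn_Int by simp

lemma bridge_Int:
  assumes "insert a (insert b (Z \<union> T)) \<subseteq> V" "a \<notin> Z \<union> T" "b \<notin> Z \<union> T" "Z \<inter> T = {}"
  shows "(drawn (insert a Z) \<union> drawn (insert b Z)) \<inter> (drawn (insert a T) \<union> drawn (insert b T)) \<subseteq> {p a, p b}"
proof -
  have "drawn (insert a Z) \<inter> drawn (insert a T) \<subseteq> drawn {a}" "drawn (insert b Z) \<inter> drawn (insert b T) \<subseteq> drawn {b}"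
    by (rule drawn_Int_subset; use assms in auto)+
  moreover have "drawn (insert a Z) \<inter> drawn (insert b T) \<subseteq> drawn {a, b}" if "a = b"
    using calculation that by simp
  moreover have "drawn (insert a Z) \<inter> drawn (insert b T) = {}" "drawn (insert b Z) \<inter> drawn (insert a T) = {}" if "a \<noteq> b"
    by (rule drawn_disjoint; use assms that in auto)+
  ultimately show ?thesis by (cases "a = b") auto
qed

text \<open>The sides of the K(3,3) are \<open>a\<close>, \<open>b\<close>, \<open>C\<close> and
  \<open>Z\<close>, \<open>T\<close>, \<open>X\<close>. The bridges \<open>g1\<close> through
  \<open>Z\<close> and \<open>g2\<close> through \<open>T\<close> form the Jordan curve
  \<open>J\<close>; \<open>K\<close> is the third bridge, and \<open>Y\<close> runs from
  \<open>g1\<close> to \<open>g2\<close> by way of \<open>C\<close>. Now \<open>K\<close> (up to its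
  ends on \<open>J\<close>) and \<open>Y\<close> lie on the same side. From the other side,
  \<open>Y\<close> is reached at \<open>h v\<close> while avoiding \<open>g1\<close> and
  \<open>K\<close>, and at \<open>h u\<close> while avoiding \<open>g2\<close> and \<open>K\<close>.
  The two obstacles meet in the continuum \<open>K\<close>, so their union does not separate either,
  although it contains \<open>J\<close>.\<close>

lemma no_K33:
  assumes V: "insert a (insert b (C \<union> Z \<union> T \<union> X)) \<subseteq> V" and ab: "a \<noteq> b"
    and out: "a \<notin> C \<union> Z \<union> T \<union> X" "b \<notin> C \<union> Z \<union> T \<union> X"
    and dis: "C \<inter> Z = {}" "C \<inter> T = {}" "C \<inter> X = {}" "Z \<inter> T = {}" "Z \<inter> X = {}" "T \<inter> X = {}"
    and con: "conn E C" "conn E Z" "conn E T" "conn E X"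
    and Z: "joined E {a} Z" "joined E {b} Z" "joined E C Z"
    and T: "joined E {a} T" "joined E {b} T" "joined E C T"
    and X: "joined E {a} X" "joined E {b} X" "joined E C X"
  shows False
proof -
  have VS: "insert a Z \<subseteq> V" "insert b Z \<subseteq> V" "insert a T \<subseteq> V" "insert b T \<subseteq> V" "insert a X \<subseteq> V" "insert b X \<subseteq> V"
    "Z \<union> C \<subseteq> V" "T \<union> C \<subseteq> V" "C \<union> X \<subseteq> V" "C \<subseteq> V" "Z \<subseteq> V" "T \<subseteq> V" "X \<subseteq> V" "{a} \<subseteq> V" "{b} \<subseteq> V"
    using V by auto
  obtain g1 where g1: "arc g1" "pathstart g1 = p a" "pathfinish g1 = p b"
    "path_image g1 \<subseteq> drawn (insert a Z) \<union> drawn (insert b Z)" "path_image g1 \<inter> drawn Z \<noteq> {}"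
    using bridge_arc[of Z a b] con Z out ab VS by auto
  obtain g2 where g2: "arc g2" "pathstart g2 = p a" "pathfinish g2 = p b"
    "path_image g2 \<subseteq> drawn (insert a T) \<union> drawn (insert b T)" "path_image g2 \<inter> drawn T \<noteq> {}"
    using bridge_arc[of T a b] con T out ab VS by auto
  define J where "J = path_image g1 \<union> path_image g2"
  define K where "K = drawn (insert a X) \<union> drawn (insert b X)"
  have pab: "p a \<in> path_image g1" "p b \<in> path_image g1" "p a \<in> path_image g2" "p b \<in> path_image g2"
    using g1 g2 by (metis pathstart_in_path_image pathfinish_in_path_image)+
  have ZT: "(drawn (insert a Z) \<union> drawn (insert b Z)) \<inter> (drawn (insert a T) \<union> drawn (insert b T)) \<subseteq> {p a, p b}"
    by (rule bridge_Int) (use V out dis in auto)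
  have ZX: "(drawn (insert a Z) \<union> drawn (insert b Z)) \<inter> K \<subseteq> {p a, p b}"
    unfolding K_def by (rule bridge_Int) (use V out dis in auto)
  have TX: "(drawn (insert a T) \<union> drawn (insert b T)) \<inter> K \<subseteq> {p a, p b}"
    unfolding K_def by (rule bridge_Int) (use V out dis in auto)
  have gg: "path_image g1 \<inter> path_image g2 \<subseteq> {p a, p b}" "path_image g1 \<inter> K \<subseteq> {p a, p b}"
    "path_image g2 \<inter> K \<subseteq> {p a, p b}"
    using ZT ZX TX g1(4) g2(4) by blast+
  define c where "c = g1 +++ reversepath g2"
  have c: "simple_path c" "pathfinish c = pathstart c" "path_image c = J"
    unfolding c_def J_def using g1(1-3) g2(1-3) gg(1)
    by (auto simp: path_image_join intro!: simple_path_join_loop arc_reversepath)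
  have Kconn: "connected K"
  proof -
    have "drawn (insert a X) \<inter> drawn (insert b X) \<noteq> {}" using drawn_mono[of X "insert a X"] drawn_mono[of X "insert b X"] X(1)
      unfolding joined_def by (metis drawn_eq_empty Int_greatest bot.extremum_uniqueI empty_iff subset_insertI)
    then show ?thesis unfolding K_def
      by (intro connected_Un connected_drawn conn_insert) (use con X in auto)
  qed
  have Kcl: "compact K" unfolding K_def using VS compact_drawn by (intro compact_Un) auto
  \<comment> \<open>Two drawings again, to leave out the edges between \<open>Z\<close> and
    \<open>T\<close>: then \<open>H\<close> meets the bridges only in \<open>drawn Z\<close> and
    \<open>drawn T\<close>, and a path between these must pass \<open>drawn C\<close>.\<close>
  define H where "H = drawn (Z \<union> C) \<union> drawn (T \<union> C)"
  have H1: "H \<inter> (drawn (insert a Z) \<union> drawn (insert b Z)) \<subseteq> drawn Z"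
  proof -
    have "drawn A \<inter> drawn B \<subseteq> drawn Z" if "A \<in> {Z \<union> C, T \<union> C}" "B \<in> {insert a Z, insert b Z}" for A B
      by (rule drawn_Int_subset) (use that V out dis in auto)
    then show ?thesis unfolding H_def by blast
  qed
  have H2: "H \<inter> (drawn (insert a T) \<union> drawn (insert b T)) \<subseteq> drawn T"
  proof -
    have "drawn A \<inter> drawn B \<subseteq> drawn T" if "A \<in> {Z \<union> C, T \<union> C}" "B \<in> {insert a T, insert b T}" for A B
      by (rule drawn_Int_subset) (use that V out dis in auto)
    then show ?thesis unfolding H_def by blast
  qed
  have Cne: "C \<noteq> {}" using X unfolding joined_def by blast
  have "conn E (Z \<union> C)" "conn E (T \<union> C)"
    using conn_Un[OF con(2,1)] conn_Un[OF con(3,1)] Z(3) T(3) joined_sym by metis+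
  moreover have "drawn (Z \<union> C) \<inter> drawn (T \<union> C) \<noteq> {}"
    using drawn_mono[of C "Z \<union> C"] drawn_mono[of C "T \<union> C"] Cne drawn_eq_empty[of C] by blast
  ultimately have "path_connected H"
    unfolding H_def by (intro path_connected_Un path_connected_drawn)
  moreover obtain m1 where m1: "m1 \<in> path_image g1" "m1 \<in> drawn Z" using g1 by blast
  moreover obtain m2 where m2: "m2 \<in> path_image g2" "m2 \<in> drawn T" using g2 by blast
  moreover have "m1 \<in> H" "m2 \<in> H"
    using m1 m2 drawn_mono[of Z "Z \<union> C"] drawn_mono[of T "T \<union> C"] unfolding H_def by auto
  ultimately obtain h where h: "path h" "path_image h \<subseteq> H" "pathstart h = m1" "pathfinish h = m2"
    unfolding path_connected_def by meson
  have DD: "drawn Z \<inter> drawn T = {}" "drawn Z \<inter> drawn C = {}" "drawn T \<inter> drawn C = {}"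
    by (rule drawn_disjoint; use VS dis in auto)+
  \<comment> \<open>\<open>Y\<close> has to avoid \<open>J\<close> and yet have points of both
    bridges in its closure; this is achieved by the open stretch between two consecutive
    contacts.\<close>
  obtain u v where uv: "0 \<le> u" "u < v" "v \<le> 1" "h u \<in> path_image g1 \<inter> drawn Z" "h v \<in> path_image g2 \<inter> drawn T"
    "h ` {u<..<v} \<inter> (path_image g1 \<inter> drawn Z \<union> path_image g2 \<inter> drawn T) = {}"
    using path_crossing_segment[OF h(1), of "path_image g1 \<inter> drawn Z" "path_image g2 \<inter> drawn T"] h m1 m2 DD closed_drawn VS
      closed_arc_image[OF g1(1)] closed_arc_image[OF g2(1)] by blast
  define Y where "Y = h ` {u<..<v}"
  have hcont: "continuous_on {u..v} h"
    using h(1) uv by (auto simp: path_def intro: continuous_on_subset)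
  have Ycon: "connected Y"
    unfolding Y_def by (rule connected_continuous_image[OF continuous_on_subset[OF hcont]]) auto
  have sub01: "{u..v} \<subseteq> {0..1}" using uv by auto
  then have YH': "h ` {u..v} \<subseteq> H" using h(2) unfolding path_image_def by blast
  then have YH: "Y \<subseteq> H" unfolding Y_def by auto
  have Ycl: "h u \<in> closure Y" "h v \<in> closure Y"
  proof -
    have "h ` closure {u<..<v} \<subseteq> closure Y"
      by (rule image_closure_subset) (use hcont uv closure_subset[of Y] in \<open>auto simp: Y_def\<close>)
    then show "h u \<in> closure Y" "h v \<in> closure Y" using uv by auto
  qed
  have YJ: "Y \<inter> J = {}"
    using YH H1 H2 g1(4) g2(4) uv(6) unfolding J_def Y_def by blast
  have YK: "Y \<inter> K = {}"
  proof -
    have "drawn A \<inter> drawn B = {}" if "A \<in> {Z \<union> C, T \<union> C}" "B \<in> {insert a X, insert b X}" for A B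
      by (rule drawn_disjoint) (use that V out dis in auto)
    then have "H \<inter> K = {}" unfolding H_def K_def by blast
    then show ?thesis using YH by blast
  qed
  have YC: "Y \<inter> drawn C \<noteq> {}"
  proof -
    have "h ` {u..v} \<inter> (drawn (Z \<union> C) \<inter> drawn (T \<union> C)) \<noteq> {}"
    proof (rule connected_meets_Int)
      show "connected (h ` {u..v})" using hcont by (intro connected_continuous_image) auto
      have "h u \<in> drawn (Z \<union> C)" "h v \<in> drawn (T \<union> C)" "h u \<in> h ` {u..v}" "h v \<in> h ` {u..v}"
        using uv drawn_mono[of Z "Z \<union> C"] drawn_mono[of T "T \<union> C"] by auto
      then show "h ` {u..v} \<inter> drawn (Z \<union> C) \<noteq> {}" "h ` {u..v} \<inter> drawn (T \<union> C) \<noteq> {}" by blast+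
    qed (use closed_drawn VS YH' in \<open>auto simp: H_def\<close>)
    moreover have "(Z \<union> C) \<inter> (T \<union> C) = C" using dis by blast
    ultimately have "h ` {u..v} \<inter> drawn C \<noteq> {}" using drawn_Int VS by metis
    then obtain t where t: "t \<in> {u..v}" "h t \<in> drawn C" by blast
    then have "t \<noteq> u" "t \<noteq> v" using uv DD by auto
    then have "h t \<in> Y" using t unfolding Y_def by auto
    then show ?thesis using t by blast
  qed
  \<comment> \<open>\<open>Big\<close> connects \<open>Y\<close> with \<open>K\<close> minus the two
    points on \<open>J\<close>. Hence the other side \<open>W\<close> avoids \<open>K\<close> as
    well.\<close>
  define Big where "Big = drawn (C \<union> X) \<union> \<Union>{Y, drawn (insert a X) - {p a}, drawn (insert b X) - {p b}}"
  note a_min = drawn_insert_minus[OF con(4) VS(5) _ X(1)] and b_min = drawn_insert_minus[OF con(4) VS(6) _ X(2)]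
  have DX: "drawn X \<subseteq> drawn (C \<union> X)" "drawn C \<subseteq> drawn (C \<union> X)" "drawn X \<noteq> {}" using drawn_mono X(1) by (auto simp: joined_def)
  have Bcon: "connected Big"
    unfolding Big_def
  proof (rule connected_Un_family)
    show "connected (drawn (C \<union> X))" by (intro connected_drawn conn_Un) (use con X in auto)
    show "connected S \<and> S \<inter> drawn (C \<union> X) \<noteq> {}" if "S \<in> {Y, drawn (insert a X) - {p a}, drawn (insert b X) - {p b}}" for S
      using that Ycon YC a_min(1,3) b_min(1,3) DX out by blast
  qed (use DX in blast)
  have CXJ: "drawn (C \<union> X) \<inter> J = {}"
  proof -
    have "drawn (C \<union> X) \<inter> drawn B = {}" if "B \<in> {insert a Z, insert b Z, insert a T, insert b T}" for B
      by (rule drawn_disjoint) (use that V out dis in auto)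
    then have "drawn (C \<union> X) \<inter> (drawn (insert a Z) \<union> drawn (insert b Z)) = {}" "drawn (C \<union> X) \<inter> (drawn (insert a T) \<union> drawn (insert b T)) = {}"
      by (simp_all add: Int_Un_distrib)
    then have "drawn (C \<union> X) \<inter> path_image g1 = {}" "drawn (C \<union> X) \<inter> path_image g2 = {}"
      using g1(4) g2(4) by blast+
    then show ?thesis unfolding J_def by blast
  qed
  have aX: "p b \<notin> drawn (insert a X)" "p a \<notin> drawn (insert b X)"
    using drawn_disjoint[of "insert a X" "{b}"] drawn_disjoint[of "insert b X" "{a}"] VS out ab by auto
  have BJ: "Big \<inter> J = {}"
  proof -
    have "K \<inter> J \<subseteq> {p a, p b}" using gg(2,3) unfolding J_def by blast
    then have "(drawn (insert a X) - {p a}) \<inter> J = {}" "(drawn (insert b X) - {p b}) \<inter> J = {}"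
      using aX unfolding K_def by blast+
    then show ?thesis using CXJ YJ unfolding Big_def by blast
  qed
  obtain W where W: "W \<noteq> {}" "connected W" "W \<inter> J = {}" "J \<subseteq> closure W" "W \<inter> Big = {}"
    "\<And>w y. w \<in> W \<Longrightarrow> y \<in> Big \<Longrightarrow> \<not> connected_component (- J) y w"
    using Jordan_other_side[OF c(1,2), of Big] Bcon BJ c(3) by metis
  obtain w where w: "w \<in> W" using W by blast
  obtain y where y: "y \<in> Y" using YC by blast
  have KB: "K \<subseteq> Big \<union> J" using pab unfolding K_def Big_def J_def by blast
  have YB: "Y \<subseteq> Big" unfolding Big_def by blast
  \<comment> \<open>The points \<open>p a\<close> and \<open>p b\<close> are outside
    \<open>drawn Z\<close> and \<open>drawn T\<close>, so \<open>h u\<close> and \<open>h v\<close>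
    are inner points of their bridges, off the other bridge and off \<open>K\<close>.\<close>
  have huK: "h u \<notin> path_image g2 \<union> K" "h v \<notin> path_image g1 \<union> K"
  proof -
    have "p a \<notin> drawn Z" "p b \<notin> drawn Z" "p a \<notin> drawn T" "p b \<notin> drawn T"
      using drawn_disjoint[of "{a}" Z] drawn_disjoint[of "{b}" Z] drawn_disjoint[of "{a}" T] drawn_disjoint[of "{b}" T] VS out by auto
    then have "h u \<notin> {p a, p b}" "h v \<notin> {p a, p b}" using uv(4,5) by auto
    then show "h u \<notin> path_image g2 \<union> K" "h v \<notin> path_image g1 \<union> K"
      using subsetD[OF gg(1), of "h u"] subsetD[OF gg(1), of "h v"] subsetD[OF gg(2), of "h u"]
        subsetD[OF gg(3), of "h v"] uv(4,5) by auto
  qed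
  have "connected_component (- (path_image g1 \<union> K)) y w"
    by (rule connected_component_via_closure_point[OF W(2) Ycon w y, of "h v"])
      (use W uv Ycl huK KB YJ YK in \<open>auto simp: J_def\<close>)
  moreover have "connected_component (- (path_image g2 \<union> K)) y w"
    by (rule connected_component_via_closure_point[OF W(2) Ycon w y, of "h u"])
      (use W uv Ycl huK KB YJ YK in \<open>auto simp: J_def\<close>)
  moreover have "(path_image g1 \<union> K) \<inter> (path_image g2 \<union> K) = K"
  proof -
    have "p a \<in> K" "p b \<in> K" unfolding K_def using p_in_drawn by auto
    then show ?thesis using gg(1) by blast
  qed
  moreover have "compact (path_image g1 \<union> K)" "closed (path_image g2 \<union> K)"
    using Kcl g1(1) g2(1) by (auto intro!: compact_Un compact_arc_image compact_imp_closed)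
  ultimately have "connected_component (- ((path_image g1 \<union> K) \<union> (path_image g2 \<union> K))) y w"
    using Kconn Janiszewski[of "path_image g1 \<union> K" "path_image g2 \<union> K" y w] by simp
  then have "connected_component (- J) y w"
    by (rule connected_component_of_subset) (auto simp: J_def)
  then show False using W(6)[OF w] y YB by blast
qed

text \<open>The K(5) has the corners \<open>a\<close>, \<open>b\<close>, \<open>c\<close> of a
  triangle with sides \<open>P\<close>, \<open>Q\<close>, \<open>R\<close>, and the sets
  \<open>T\<close> and \<open>X\<close>. The triangle contains the Jordan curve \<open>J\<close>;
  \<open>T\<close> and \<open>X\<close> are on the same side because they are joined. Each side arc
  closed up through \<open>X\<close> misses the opposite corner, where \<open>Y\<close> (the set
  \<open>T\<close> with its spokes) and the far side of \<open>J\<close> touch, so it does not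
  separate them. Two applications of Janiszewski's theorem combine the three obstacles to one that
  contains \<open>J\<close>.\<close>

lemma no_K5:
  assumes V: "P \<union> Q \<union> R \<union> T \<union> X \<subseteq> V"
    and abc: "a \<in> R" "a \<in> P" "b \<in> P" "b \<in> Q" "c \<in> Q" "c \<in> R" "a \<noteq> b" "b \<noteq> c" "a \<noteq> c"
    and PQR: "P \<inter> Q = {b}" "Q \<inter> R = {c}" "R \<inter> P = {a}"
    and dis: "X \<inter> (P \<union> Q \<union> R) = {}" "T \<inter> (P \<union> Q \<union> R) = {}" "T \<inter> X = {}"
    and con: "conn E P" "conn E Q" "conn E R" "conn E T" "conn E X"
    and X: "joined E {a} X" "joined E {b} X" "joined E {c} X"
    and T: "joined E {a} T" "joined E {b} T" "joined E {c} T" and TX: "joined E T X"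
  shows False
proof -
  have VS: "P \<subseteq> V" "Q \<subseteq> V" "R \<subseteq> V" "T \<subseteq> V" "X \<subseteq> V" "T \<union> X \<subseteq> V"
    "insert a X \<subseteq> V" "insert b X \<subseteq> V" "insert c X \<subseteq> V" "insert a T \<subseteq> V" "insert b T \<subseteq> V" "insert c T \<subseteq> V"
    using V abc by auto
  have out: "a \<notin> X" "b \<notin> X" "c \<notin> X" "a \<notin> T" "b \<notin> T" "c \<notin> T" using dis abc by auto
  have meet: "drawn A \<inter> drawn B = {p x}" if "A \<subseteq> V" "B \<subseteq> V" "A \<inter> B = {x}" for A B x
    using drawn_Int that by simp
  have pne: "p a \<noteq> p b" "p b \<noteq> p c" "p a \<noteq> p c"
    using inj_onD[OF inj_p] VS abc by (metis subset_iff)+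
  have arc: "\<exists>g. arc g \<and> path_image g \<subseteq> drawn A \<and> pathstart g = p x \<and> pathfinish g = p y"
    if "conn E A" "x \<in> A" "y \<in> A" "p x \<noteq> p y" for A x y
    using arc_in_path_connected[OF path_connected_drawn[OF that(1)], of "p x" "p y"] that p_in_drawn by metis
  obtain g1 where g1: "arc g1" "path_image g1 \<subseteq> drawn P" "pathstart g1 = p a" "pathfinish g1 = p b"
    using arc[OF con(1), of a b] abc pne by auto
  obtain g2 where g2: "arc g2" "path_image g2 \<subseteq> drawn Q" "pathstart g2 = p b" "pathfinish g2 = p c"
    using arc[OF con(2), of b c] abc pne by auto
  obtain g3 where g3: "arc g3" "path_image g3 \<subseteq> drawn R" "pathstart g3 = p c" "pathfinish g3 = p a"
    using arc[OF con(3), of c a] abc pne by auto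
  have PQR': "drawn P \<inter> drawn Q = {p b}" "drawn Q \<inter> drawn R = {p c}" "drawn R \<inter> drawn P = {p a}"
    using meet VS PQR by auto
  have ends: "p a \<in> path_image g1" "p b \<in> path_image g1" "p b \<in> path_image g2" "p c \<in> path_image g2"
    "p c \<in> path_image g3" "p a \<in> path_image g3"
    using g1 g2 g3 by (metis pathstart_in_path_image pathfinish_in_path_image)+
  define J where "J = path_image g1 \<union> path_image g2 \<union> path_image g3"
  define cy where "cy = (g1 +++ g2) +++ g3"
  have "arc (g1 +++ g2)" using g1 g2 PQR' by (intro arc_join) auto
  then have cy: "simple_path cy" "pathfinish cy = pathstart cy" "path_image cy = J"
  proof -
    have "(path_image g1 \<union> path_image g2) \<inter> path_image g3 \<subseteq> {p a, p c}"
      using PQR' g1(2) g2(2) g3(2) by blast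
    with \<open>arc (g1 +++ g2)\<close> show "simple_path cy" "pathfinish cy = pathstart cy" "path_image cy = J"
      unfolding cy_def J_def using g1 g2 g3
      by (auto simp: path_image_join intro!: simple_path_join_loop)
  qed
  have "a \<notin> P \<inter> Q" "b \<notin> Q \<inter> R" "c \<notin> R \<inter> P" unfolding PQR using abc by auto
  then have nabc: "a \<notin> Q" "b \<notin> R" "c \<notin> P" using abc(1-6) by auto
  \<comment> \<open>\<open>A x\<close> keeps the tip \<open>p x\<close>, so that it contains the
    common point of two adjacent arcs of \<open>J\<close>. \<open>B x\<close> loses it, so that
    \<open>Y\<close> stays off \<open>J\<close> while \<open>p x\<close> is still in its
    closure.\<close>
  define A where "A x = drawn (insert x X)" for x
  define B where "B x = drawn (insert x T) - {p x}" for x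
  have J_sub: "J \<subseteq> drawn P \<union> drawn Q \<union> drawn R" using g1(2) g2(2) g3(2) unfolding J_def by blast
  have XP: "A a \<inter> drawn P = {p a}" "A b \<inter> drawn P = {p b}" "A c \<inter> drawn P = {}"
    "A b \<inter> drawn Q = {p b}" "A c \<inter> drawn Q = {p c}" "A a \<inter> drawn Q = {}"
    "A c \<inter> drawn R = {p c}" "A a \<inter> drawn R = {p a}" "A b \<inter> drawn R = {}"
    unfolding A_def by (rule meet drawn_disjoint; use VS(1-3,7-9) abc(1-6) nabc dis(1) in auto)+
  have TP: "B x \<inter> drawn S = {}" if "x \<in> {a, b, c}" "S \<in> {P, Q, R}" for x S
  proof -
    have "insert x T \<inter> S \<subseteq> {x}" "insert x T \<subseteq> V" "S \<subseteq> V" using that VS dis(2) by auto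
    then have "drawn (insert x T) \<inter> drawn S \<subseteq> {p x}" using drawn_Int[of "insert x T" S] drawn_mono[of "insert x T \<inter> S" "{x}"] by auto
    then show ?thesis unfolding B_def by blast
  qed
  have TXd: "B x \<inter> A z = {}" if "x \<in> {a, b, c}" "z \<in> {a, b, c}" for x z
  proof -
    have "insert x T \<inter> insert z X \<subseteq> {x}" "insert x T \<subseteq> V" "insert z X \<subseteq> V" using that VS dis out by auto
    then have "drawn (insert x T) \<inter> drawn (insert z X) \<subseteq> {p x}"
      using drawn_Int[of "insert x T" "insert z X"] drawn_mono[of "insert x T \<inter> insert z X" "{x}"] by auto
    then show ?thesis unfolding A_def B_def by blast
  qed
  have AA: "A a \<inter> A b = drawn X" "A b \<inter> A c = drawn X" "A a \<inter> A c = drawn X"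
  proof -
    have "insert a X \<inter> insert b X = X" "insert b X \<inter> insert c X = X" "insert a X \<inter> insert c X = X"
      using abc out by auto
    then show "A a \<inter> A b = drawn X" "A b \<inter> A c = drawn X" "A a \<inter> A c = drawn X" unfolding A_def using drawn_Int VS by metis+
  qed
  have DXA: "drawn X \<subseteq> A a" "drawn X \<subseteq> A b" "drawn X \<subseteq> A c" "drawn X \<noteq> {}" "drawn T \<noteq> {}"
    unfolding A_def using X T by (auto intro!: drawn_mono simp: joined_def)
  have Acon: "connected (A a)" "connected (A b)" "connected (A c)"
    unfolding A_def by (intro connected_drawn conn_insert con X)+
  have pA: "p a \<in> A a" "p b \<in> A b" "p c \<in> A c" unfolding A_def using p_in_drawn by auto
  have Acl: "compact (A a)" "compact (A b)" "compact (A c)" unfolding A_def using compact_drawn VS by auto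
  have Bt: "connected (B x)" "p x \<in> closure (B x)" "drawn T \<subseteq> B x" if "x \<in> {a, b, c}" for x
    unfolding B_def by (rule drawn_insert_minus[OF con(4)]; use that VS out T in blast)+
  have At: "connected (A x - {p x})" "drawn X \<subseteq> A x - {p x}" if "x \<in> {a, b, c}" for x
    unfolding A_def by (rule drawn_insert_minus[OF con(5)]; use that VS out X in blast)+
  define Y where "Y = drawn T \<union> \<Union>{B a, B b, B c}"
  have Ycon: "connected Y"
    unfolding Y_def
  proof (rule connected_Un_family[OF connected_drawn[OF con(4)] _ DXA(5)])
    fix S assume "S \<in> {B a, B b, B c}"
    then obtain x where "x \<in> {a, b, c}" "S = B x" by blast
    then show "connected S \<and> S \<inter> drawn T \<noteq> {}" using Bt(1,3)[of x] DXA(5) by (simp add: Int_absorb1)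
  qed
  \<comment> \<open>The edge between \<open>T\<close> and \<open>X\<close> ties \<open>Y\<close> to
    the spokes \<open>A x\<close> without their tips; so \<open>W\<close>, on the other side, avoids
    every \<open>A x\<close>.\<close>
  define Big where "Big = drawn (T \<union> X) \<union> \<Union>{Y, A a - {p a}, A b - {p b}, A c - {p c}}"
  have DTX: "drawn T \<subseteq> drawn (T \<union> X)" "drawn X \<subseteq> drawn (T \<union> X)" using drawn_mono by auto
  have Bcon: "connected Big"
    unfolding Big_def
  proof (rule connected_Un_family)
    show "connected (drawn (T \<union> X))" by (intro connected_drawn conn_Un) (use con TX in auto)
    show "connected S \<and> S \<inter> drawn (T \<union> X) \<noteq> {}" if S: "S \<in> {Y, A a - {p a}, A b - {p b}, A c - {p c}}" for S
    proof -
      have "drawn T \<subseteq> Y" unfolding Y_def by blast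
      then have "connected S \<and> (drawn T \<subseteq> S \<or> drawn X \<subseteq> S)" using S At Ycon by auto
      then show ?thesis using DTX DXA(4,5) by blast
    qed
  qed (use DTX DXA(4) in blast)
  have TXJ: "drawn (T \<union> X) \<inter> J = {}"
  proof -
    have "drawn (T \<union> X) \<inter> drawn S = {}" if "S \<in> {P, Q, R}" for S
      by (rule drawn_disjoint) (use that VS dis in auto)
    then have "drawn (T \<union> X) \<inter> drawn P = {}" "drawn (T \<union> X) \<inter> drawn Q = {}" "drawn (T \<union> X) \<inter> drawn R = {}" by simp_all
    then show ?thesis using J_sub by blast
  qed
  have YJ: "Y \<inter> J = {}"
  proof -
    have "drawn T \<inter> J = {}" using TXJ DTX by blast
    moreover have "B x \<inter> J = {}" if "x \<in> {a, b, c}" for x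
      using TP[OF that, of P] TP[OF that, of Q] TP[OF that, of R] J_sub by blast
    ultimately show ?thesis unfolding Y_def by (simp add: Int_Un_distrib2)
  qed
  have BJ: "Big \<inter> J = {}"
  proof -
    have "A x \<inter> J \<subseteq> (A x \<inter> drawn P) \<union> (A x \<inter> drawn Q) \<union> (A x \<inter> drawn R)" for x using J_sub by blast
    from this[of a] this[of b] this[of c]
    have "A a \<inter> J \<subseteq> {p a}" "A b \<inter> J \<subseteq> {p b}" "A c \<inter> J \<subseteq> {p c}" unfolding XP by simp_all
    then have "(A a - {p a}) \<inter> J = {}" "(A b - {p b}) \<inter> J = {}" "(A c - {p c}) \<inter> J = {}" by blast+
    then show ?thesis using TXJ YJ unfolding Big_def by (simp add: Int_Un_distrib2)
  qed
  have YA: "Y \<inter> A a = {}" "Y \<inter> A b = {}" "Y \<inter> A c = {}"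
  proof -
    have "Y \<inter> A z = {}" if z: "z \<in> {a, b, c}" for z
    proof -
      have "B a \<inter> A z = {}" "B b \<inter> A z = {}" "B c \<inter> A z = {}" using TXd z by simp_all
      then show ?thesis using Bt(3)[of a] unfolding Y_def by auto
    qed
    then show "Y \<inter> A a = {}" "Y \<inter> A b = {}" "Y \<inter> A c = {}" by simp_all
  qed
  obtain W where W: "W \<noteq> {}" "connected W" "W \<inter> J = {}" "J \<subseteq> closure W" "W \<inter> Big = {}"
    "\<And>w y. w \<in> W \<Longrightarrow> y \<in> Big \<Longrightarrow> \<not> connected_component (- J) y w"
    using Jordan_other_side[OF cy(1,2), of Big] Bcon BJ cy(3) by metis
  obtain w where w: "w \<in> W" using W by blast
  obtain y where y: "y \<in> Y" using DXA unfolding Y_def by blast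
  have JJ: "p a \<in> J" "p b \<in> J" "p c \<in> J" using ends unfolding J_def by auto
  have AW: "A a \<inter> W = {}" "A b \<inter> W = {}" "A c \<inter> W = {}"
    using W(3,5) JJ unfolding Big_def by blast+
  have gW: "path_image g1 \<inter> W = {}" "path_image g2 \<inter> W = {}" "path_image g3 \<inter> W = {}"
    and gY: "path_image g1 \<inter> Y = {}" "path_image g2 \<inter> Y = {}" "path_image g3 \<inter> Y = {}"
    using W(3) YJ unfolding J_def by blast+
  have Ycl: "p a \<in> closure Y" "p b \<in> closure Y" "p c \<in> closure Y"
  proof -
    have "B a \<subseteq> Y" "B b \<subseteq> Y" "B c \<subseteq> Y" unfolding Y_def by auto
    then show "p a \<in> closure Y" "p b \<in> closure Y" "p c \<in> closure Y"
      using Bt(2) closure_mono by blast+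
  qed
  have nA: "p c \<notin> A a" "p c \<notin> A b" "p a \<notin> A b" "p a \<notin> A c" "p b \<notin> A a" "p b \<notin> A c"
  proof -
    have pP: "p a \<in> drawn P" "p b \<in> drawn P" "p b \<in> drawn Q" "p c \<in> drawn Q" "p c \<in> drawn R" "p a \<in> drawn R"
      using abc by (auto intro: p_in_drawn)
    show "p c \<notin> A a" "p c \<notin> A b" using pP XP(6,9) by blast+
    show "p a \<notin> A b" "p a \<notin> A c" using pP XP(9,3) by blast+
    show "p b \<notin> A a" "p b \<notin> A c" using pP XP(6,3) by blast+
  qed
  have ng: "p c \<notin> path_image g1" "p a \<notin> path_image g2" "p b \<notin> path_image g3"
  proof -
    have "p c \<notin> drawn P" "p a \<notin> drawn Q" "p b \<notin> drawn R"
      using drawn_disjoint[of "{c}" P] drawn_disjoint[of "{a}" Q] drawn_disjoint[of "{b}" R] VS nabc abc by auto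
    then show "p c \<notin> path_image g1" "p a \<notin> path_image g2" "p b \<notin> path_image g3"
      using g1(2) g2(2) g3(2) by blast+
  qed
  define S1 where "S1 = A a \<union> A b \<union> path_image g1"
  define S2 where "S2 = A b \<union> A c \<union> path_image g2"
  define S3 where "S3 = A c \<union> A a \<union> path_image g3"
  have cpt: "compact S1" "compact S2" "compact S3"
    unfolding S1_def S2_def S3_def using Acl g1(1) g2(1) g3(1) by (auto intro!: compact_Un compact_arc_image)
  have cc1: "connected_component (- S1) y w"
    by (rule connected_component_via_closure_point[OF W(2) Ycon w y, of "p c"])
      (use W(4) JJ Ycl AW gW gY YA nA ng in \<open>auto simp: S1_def\<close>)
  have cc2: "connected_component (- S2) y w"
    by (rule connected_component_via_closure_point[OF W(2) Ycon w y, of "p a"])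
      (use W(4) JJ Ycl AW gW gY YA nA ng in \<open>auto simp: S2_def\<close>)
  have cc3: "connected_component (- S3) y w"
    by (rule connected_component_via_closure_point[OF W(2) Ycon w y, of "p b"])
      (use W(4) JJ Ycl AW gW gY YA nA ng in \<open>auto simp: S3_def\<close>)
  have gA: "path_image g1 \<inter> A c = {}" "path_image g2 \<inter> A a = {}" "path_image g3 \<inter> A b = {}"
  proof -
    have "drawn P \<inter> A c = {}" "drawn Q \<inter> A a = {}" "drawn R \<inter> A b = {}" using XP(3,6,9) by (simp_all add: Int_commute)
    then show "path_image g1 \<inter> A c = {}" "path_image g2 \<inter> A a = {}" "path_image g3 \<inter> A b = {}"
      using g1(2) g2(2) g3(2) by blast+
  qed
  have gg: "path_image g1 \<inter> path_image g2 \<subseteq> A b" "path_image g2 \<inter> path_image g3 \<subseteq> A c"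
    "path_image g3 \<inter> path_image g1 \<subseteq> A a"
  proof -
    have "drawn P \<inter> drawn Q \<subseteq> A b" "drawn Q \<inter> drawn R \<subseteq> A c" "drawn R \<inter> drawn P \<subseteq> A a" unfolding PQR' using pA by simp_all
    then show "path_image g1 \<inter> path_image g2 \<subseteq> A b" "path_image g2 \<inter> path_image g3 \<subseteq> A c"
      "path_image g3 \<inter> path_image g1 \<subseteq> A a"
      using g1(2) g2(2) g3(2) by blast+
  qed
  have AA': "A a \<inter> A c \<subseteq> A b" using AA(3) DXA(2) by simp
  have "S1 \<inter> S2 = A b"
    unfolding S1_def S2_def using gA(1,2) gg(1) AA' by blast
  then have cc12: "connected_component (- (S1 \<union> S2)) y w"
    using Janiszewski[OF cpt(1) compact_imp_closed[OF cpt(2)] _ cc1 cc2] Acon by simp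
  \<comment> \<open>In the second application the obstacles meet in two spokes, which are connected
    through \<open>drawn X\<close>.\<close>
  have "(S1 \<union> S2) \<inter> S3 = A a \<union> A c"
    unfolding S1_def S2_def S3_def using gA(3) gg(2,3) by blast
  moreover have "connected (A a \<union> A c)" using Acon AA DXA by (intro connected_Un) auto
  ultimately have "connected_component (- ((S1 \<union> S2) \<union> S3)) y w"
    using Janiszewski[OF compact_Un[OF cpt(1,2)] compact_imp_closed[OF cpt(3)] _ cc12 cc3] by simp
  then have "connected_component (- J) y w"
    by (rule connected_component_of_subset) (auto simp: J_def S1_def S2_def S3_def)
  moreover have "y \<in> Big" using y unfolding Big_def by blast
  ultimately show False using W(6)[OF w] by blast
qed

subsection \<open>Vertices with few neighbours on the boundary\<close>

lemma edge_neq: "{x, y} \<in> E \<Longrightarrow> x \<noteq> y"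
  using edge_card by fastforce

lemma connecting_block:
  assumes "conn E A" "x \<in> A" "y \<in> A" "x \<noteq> y"
  obtains T where "T \<subseteq> A - {x, y}" "conn E (insert x (insert y T))"
    "T = {} \<or> (\<exists>t \<in> A - {x, y}. T = component E (A - {x, y}) t \<and> joined E {x} T \<and> joined E {y} T)"
  using assms
proof (cases rule: conn_path_block)
  case 1
  then show ?thesis using that[of "{}"] conn_edge[of x y E] by simp
next
  case (2 t)
  let ?T = "component E (A - {x, y}) t"
  have "conn E (insert x (insert y ?T))"
    using conn_insert[OF conn_insert[OF conn_component[OF 2(1)] 2(3)]] joined_mono[OF 2(2)] by blast
  then show ?thesis using that[of ?T] component_subset[OF 2(1)] 2 by blast
qed

text \<open>Deleting \<open>z\<close> and one of the three neighbours leaves \<open>U\<close>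
  connected, so the other two are linked by an edge or through a component of \<open>R\<close>. If
  one component touches all of \<open>a\<close>, \<open>b\<close>, \<open>c\<close>, then these
  against \<open>z\<close>, the component and \<open>X\<close> form a K(3,3). Otherwise the links
  use different components, so they form a triangle, which gives a K(5) with \<open>z\<close> and
  \<open>X\<close>.\<close>

lemma boundary_three_nbrs:
  assumes UX: "U \<subseteq> V" "X \<subseteq> V" "U \<inter> X = {}" "conn E X"
    and edge: "\<And>x y. x \<in> boundary E U X \<Longrightarrow> y \<in> boundary E U X \<Longrightarrow> {x, y} \<in> E \<Longrightarrow> conn E (U - {x, y})"
    and z: "z \<in> boundary E U X" and abc: "{a, b, c} \<subseteq> nbrs E z \<inter> boundary E U X" "a \<noteq> b" "b \<noteq> c" "a \<noteq> c"
  shows False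
proof -
  have E: "{z, a} \<in> E" "{z, b} \<in> E" "{z, c} \<in> E" using abc unfolding nbrs_def by auto
  then have ne: "z \<noteq> a" "z \<noteq> b" "z \<noteq> c" using edge_neq by blast+
  have inU: "z \<in> U" "a \<in> U" "b \<in> U" "c \<in> U" and jX: "joined E {z} X" "joined E {a} X" "joined E {b} X" "joined E {c} X"
    using z abc unfolding boundary_def by auto
  then have notX: "z \<notin> X" "a \<notin> X" "b \<notin> X" "c \<notin> X" using UX(3) by auto
  have jz: "joined E {a} {z}" "joined E {b} {z}" "joined E {c} {z}" using E unfolding joined_def by (auto simp: insert_commute)
  define R where "R = U - {z, a, b, c}"
  have no3: False if t: "t \<in> R" "joined E {a} (component E R t)" "joined E {b} (component E R t)" "joined E {c} (component E R t)" for t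
  proof (rule no_K33[of a b "{c}" "{z}" "component E R t" X])
    have "component E R t \<subseteq> U - {z, a, b, c}" using component_subset[OF t(1)] unfolding R_def .
    then show "insert a (insert b ({c} \<union> {z} \<union> component E R t \<union> X)) \<subseteq> V"
      "a \<notin> {c} \<union> {z} \<union> component E R t \<union> X" "b \<notin> {c} \<union> {z} \<union> component E R t \<union> X"
      "{c} \<inter> component E R t = {}" "{z} \<inter> component E R t = {}" "component E R t \<inter> X = {}"
      using UX inU notX ne abc by auto
  qed (use t jX jz abc ne notX UX conn_component[OF t(1)] in auto)
  have block: "\<exists>T. T \<subseteq> R \<and> conn E (insert x (insert y T)) \<and>
      (T = {} \<or> (\<exists>t\<in>R. T = component E R t \<and> joined E {x} T \<and> joined E {y} T))"
    if xyw: "{x, y, w} = {a, b, c}" "x \<noteq> y" "y \<noteq> w" "x \<noteq> w" for x y w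
  proof -
    have mem: "x \<in> {a, b, c}" "y \<in> {a, b, c}" "w \<in> {a, b, c}" unfolding xyw(1)[symmetric] by simp_all
    have all: "v \<in> boundary E U X" "{z, v} \<in> E" "v \<in> U" "v \<noteq> z" if "v \<in> {a, b, c}" for v
      using that abc(1) E inU ne by auto
    have w: "w \<in> boundary E U X" "{z, w} \<in> E" and xy: "x \<in> U - {z, w}" "y \<in> U - {z, w}"
      using all[OF mem(1)] all[OF mem(2)] all[OF mem(3)] xyw(2-4) by auto
    have "conn E (U - {z, w})" by (rule edge[OF z w])
    moreover have "U - {z, w} - {x, y} = R" unfolding R_def using xyw(1) by auto
    ultimately show ?thesis using connecting_block[of "U - {z, w}" x y] xy xyw(2) by metis
  qed
  obtain P where P: "P \<subseteq> R" "conn E (insert a (insert b P))"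
    "P = {} \<or> (\<exists>t\<in>R. P = component E R t \<and> joined E {a} P \<and> joined E {b} P)"
    using block[of a b c] abc by auto
  obtain Q where Q: "Q \<subseteq> R" "conn E (insert b (insert c Q))"
    "Q = {} \<or> (\<exists>t\<in>R. Q = component E R t \<and> joined E {b} Q \<and> joined E {c} Q)"
    using block[of b c a] abc by auto
  obtain S where S: "S \<subseteq> R" "conn E (insert c (insert a S))"
    "S = {} \<or> (\<exists>t\<in>R. S = component E R t \<and> joined E {c} S \<and> joined E {a} S)"
    using block[of c a b] abc by auto
  have PQ: "P \<inter> Q = {}" using P(3) Q(3) no3 component_disjoint[of E R] by (metis Int_empty_left Int_empty_right)
  have QS: "Q \<inter> S = {}" using Q(3) S(3) no3 component_disjoint[of E R] by (metis Int_empty_left Int_empty_right)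
  have PS: "S \<inter> P = {}" using P(3) S(3) no3 component_disjoint[of E R] by (metis Int_empty_left Int_empty_right)
  have R: "R \<subseteq> V" "z \<notin> R" "a \<notin> R" "b \<notin> R" "c \<notin> R" "R \<inter> X = {}" unfolding R_def using UX by auto
  show False
  proof (rule no_K5[of "insert a (insert b P)" "insert b (insert c Q)" "insert c (insert a S)" "{z}" X a b c])
    show "insert a (insert b P) \<inter> insert b (insert c Q) = {b}" "insert b (insert c Q) \<inter> insert c (insert a S) = {c}"
      "insert c (insert a S) \<inter> insert a (insert b P) = {a}"
      using P(1) Q(1) S(1) R PQ QS PS abc by auto
    show "insert a (insert b P) \<union> insert b (insert c Q) \<union> insert c (insert a S) \<union> {z} \<union> X \<subseteq> V"
      using P(1) Q(1) S(1) R UX inU by auto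
    show "X \<inter> (insert a (insert b P) \<union> insert b (insert c Q) \<union> insert c (insert a S)) = {}"
      "{z} \<inter> (insert a (insert b P) \<union> insert b (insert c Q) \<union> insert c (insert a S)) = {}"
      using P(1) Q(1) S(1) R notX ne by auto
  qed (use P Q S jX jz abc notX UX in auto)
qed

section \<open>Cycles in induced 2-regular graphs\<close>

lemma longest_path:
  assumes "finite A" "s \<in> A"
  obtains f :: "nat \<Rightarrow> 'v" and k where "f 0 = s" "inj_on f {0..k}" "f ` {0..k} \<subseteq> A"
    "\<And>i. i < k \<Longrightarrow> {f i, f (Suc i)} \<in> E" "nbrs E (f k) \<inter> A \<subseteq> f ` {0..k}"
proof -
  define Q where "Q = (\<lambda>(f, k). f 0 = s \<and> inj_on f {0..k::nat} \<and> f ` {0..k} \<subseteq> A \<and> (\<forall>i<k. {f i, f (Suc i)} \<in> E))"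
  have "Q (\<lambda>_. s, 0)" unfolding Q_def using assms by auto
  moreover have "k < card A" if "Q (f, k)" for f k
  proof -
    have "inj_on f {0..k}" "f ` {0..k} \<subseteq> A" using that unfolding Q_def by auto
    then have "card {0..k} \<le> card A" using assms(1) by (metis card_inj_on_le)
    then show ?thesis by simp
  qed
  ultimately obtain f k where fk: "Q (f, k)" and max: "\<And>g m. Q (g, m) \<Longrightarrow> m \<le> k"
    using ex_has_greatest_nat[of Q "(\<lambda>_. s, 0)" snd "card A"] by fastforce
  have "u \<in> f ` {0..k}" if u: "u \<in> nbrs E (f k)" "u \<in> A" for u
  proof (rule ccontr)
    assume new: "u \<notin> f ` {0..k}"
    have img: "(f(Suc k := u)) ` {0..k} = f ` {0..k}" by (auto intro: image_cong)
    have "Q (f(Suc k := u), Suc k)"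
      unfolding Q_def prod.case
    proof (intro conjI)
      show "(f(Suc k := u)) 0 = s" using fk unfolding Q_def by simp
      have "inj_on (f(Suc k := u)) {0..k}" using fk unfolding Q_def by (auto simp: inj_on_def)
      then show "inj_on (f(Suc k := u)) {0..Suc k}"
        using new img by (simp add: atLeastAtMostSuc_conv)
      show "(f(Suc k := u)) ` {0..Suc k} \<subseteq> A"
        using fk u(2) unfolding Q_def by auto
      show "\<forall>i<Suc k. {(f(Suc k := u)) i, (f(Suc k := u)) (Suc i)} \<in> E"
        using fk u(1) unfolding Q_def nbrs_def by (auto simp: less_Suc_eq)
    qed
    then show False using max by force
  qed
  then show ?thesis using that[of f k] fk unfolding Q_def by blast
qed

text \<open>On a longest path, both neighbours of the last vertex \<open>f k\<close> lie on the
  path: one is its predecessor, the other some \<open>f j\<close>. For 0 < j this \<open>f j\<close>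
  would have a third neighbour, so the path closes to a cycle at \<open>f 0\<close>.\<close>

lemma two_regular_cycle:
  assumes A: "finite A" "s \<in> A" and two: "\<And>v. v \<in> A \<Longrightarrow> card (nbrs E v \<inter> A) = 2"
  obtains f :: "nat \<Rightarrow> 'v" and k where "2 \<le> k" "f 0 = s" "inj_on f {0..k}" "f ` {0..k} \<subseteq> A"
    "\<And>i. i < k \<Longrightarrow> {f i, f (Suc i)} \<in> E" "{f k, f 0} \<in> E"
    "\<And>v. v \<in> f ` {0..k} \<Longrightarrow> nbrs E v \<inter> A \<subseteq> f ` {0..k}"
proof -
  obtain f :: "nat \<Rightarrow> 'v" and k where f: "f 0 = s" "inj_on f {0..k}" "f ` {0..k} \<subseteq> A"
    "\<And>i. i < k \<Longrightarrow> {f i, f (Suc i)} \<in> E" "nbrs E (f k) \<inter> A \<subseteq> f ` {0..k}"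
    using longest_path[OF A] by metis
  have fA: "f i \<in> A" if "i \<le> k" for i using f(3) that by auto
  have eq: "f i = f j \<longleftrightarrow> i = j" if "i \<le> k" "j \<le> k" for i j
    using inj_on_eq_iff[OF f(2)] that by auto
  have E': "{f (Suc i), f i} \<in> E" if "i < k" for i using f(4)[OF that] by (simp add: insert_commute)
  have nb: "nbrs E (f i) \<inter> A = {f j, f l}" if "{f i, f j} \<in> E" "{f i, f l} \<in> E" "j \<noteq> l" "i \<le> k" "j \<le> k" "l \<le> k" for i j l
  proof -
    have "{f j, f l} \<subseteq> nbrs E (f i) \<inter> A" using that fA unfolding nbrs_def by auto
    moreover have "card {f j, f l} = 2" using eq that by simp
    moreover have "finite (nbrs E (f i) \<inter> A)" using A by simp
    ultimately show ?thesis using card_subset_eq two[OF fA[OF that(4)]] by metis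
  qed
  have "nbrs E (f k) \<inter> A \<subseteq> f ` {0..<k}"
  proof -
    have "f k \<notin> nbrs E (f k)" unfolding nbrs_def using edge_neq by blast
    moreover have "{0..k} = insert k {0..<k}" by auto
    ultimately show ?thesis using f(5) by auto
  qed
  then have "card (nbrs E (f k) \<inter> A) \<le> card {0..<k}"
    by (meson card_image_le card_mono finite_atLeastLessThan finite_imageI le_trans)
  then have k: "2 \<le> k" using two[OF fA[of k]] by simp
  obtain u where u: "u \<in> nbrs E (f k) \<inter> A" "u \<noteq> f (k - 1)"
    using two[OF fA[of k]] by (metis (no_types, lifting) card_2_iff' order_refl)
  then obtain j where j: "j \<le> k" "u = f j" using f(5) by auto
  have jE: "{f k, f j} \<in> E" using u j unfolding nbrs_def by auto
  have jk: "j \<noteq> k" "j \<noteq> k - 1" using u j jE edge_neq by auto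
  have "j = 0"
  proof (rule ccontr)
    assume "j \<noteq> 0"
    then have "nbrs E (f j) \<inter> A = {f (j - 1), f (Suc j)}"
      using nb[of j "j - 1" "Suc j"] E'[of "j - 1"] f(4)[of j] j jk by simp
    moreover have "f k \<in> nbrs E (f j) \<inter> A" using jE fA unfolding nbrs_def by (simp add: insert_commute)
    ultimately show False using eq j jk \<open>j \<noteq> 0\<close> by auto
  qed
  then have k0: "{f k, f 0} \<in> E" using jE by simp
  have "nbrs E (f i) \<inter> A \<subseteq> f ` {0..k}" if "i \<le> k" for i
  proof -
    consider "i = k" | "i = 0" "i \<noteq> k" | "0 < i" "i < k" using \<open>i \<le> k\<close> by linarith
    then show ?thesis
    proof cases
      case 1 then show ?thesis using f(5) by simp
    next
      case 2
      have "{f 0, f k} \<in> E" using k0 by (simp add: insert_commute)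
      then have "nbrs E (f i) \<inter> A = {f 1, f k}" using nb[of 0 1 k] f(4)[of 0] k 2 by simp
      then show ?thesis using k by auto
    next
      case 3
      then have "nbrs E (f i) \<inter> A = {f (i - 1), f (Suc i)}"
        using nb[of i "i - 1" "Suc i"] E'[of "i - 1"] f(4)[of i] by simp
      then show ?thesis using 3 by auto
    qed
  qed
  then have "nbrs E v \<inter> A \<subseteq> f ` {0..k}" if "v \<in> f ` {0..k}" for v using that by fastforce
  then show ?thesis using that[of k f] k f k0 by blast
qed

text \<open>
  Otherwise the boundary outside S induces a 2-regular graph. A cycle of it, the set X, and the
  component T of a vertex of S off this cycle then form a forbidden configuration.
\<close>

lemma good_vertex:
  fixes U X S
  defines "B \<equiv> boundary E U X"
  assumes UX: "U \<subseteq> V" "X \<subseteq> V" "U \<inter> X = {}" "conn E X"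
    and conU: "conn E U" and vert: "\<And>x. x \<in> B \<Longrightarrow> conn E (U - {x})"
    and edge: "\<And>x y. x \<in> B \<Longrightarrow> y \<in> B \<Longrightarrow> {x, y} \<in> E \<Longrightarrow> conn E (U - {x, y})"
    and S: "S \<subseteq> B" "S \<noteq> {}" "S \<noteq> B"
  shows "\<exists>z \<in> B - S. card (nbrs E z \<inter> B) \<le> 2 \<and> card (nbrs E z \<inter> B - S) \<le> 1"
proof (rule ccontr)
  assume none: "\<not> ?thesis"
  have "B \<subseteq> U" unfolding B_def boundary_def by blast
  then have BU: "B \<subseteq> U" "B \<subseteq> V" "finite B" using UX finite_subset[OF _ finite_V, of B] by auto
  have jX: "joined E {v} X" if "v \<in> B" for v using that unfolding B_def boundary_def by simp
  have le2: "card (nbrs E z \<inter> B) \<le> 2" if "z \<in> B" for z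
  proof (rule ccontr)
    assume "\<not> ?thesis"
    then have "3 \<le> card (nbrs E z \<inter> B)" by simp
    then obtain T where "T \<subseteq> nbrs E z \<inter> B" "card T = 3" by (meson obtain_subset_with_card_n)
    then obtain a b c where "{a, b, c} \<subseteq> nbrs E z \<inter> B" "a \<noteq> b" "b \<noteq> c" "a \<noteq> c"
      by (metis card_3_iff)
    then show False using boundary_three_nbrs[OF UX, of z a b c] edge that unfolding B_def by blast
  qed
  \<comment> \<open>By \<open>le2\<close> a vertex that is not good must violate the second
    condition; having at most two boundary neighbours, it has exactly two, both outside
    \<open>S\<close>.\<close>
  have two: "card (nbrs E z \<inter> (B - S)) = 2" if z: "z \<in> B - S" for z
  proof -
    have "\<not> card (nbrs E z \<inter> B - S) \<le> 1" using none le2 z by blast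
    then have *: "2 \<le> card (nbrs E z \<inter> B - S)" by simp
    have sub: "nbrs E z \<inter> B - S \<subseteq> nbrs E z \<inter> B" by blast
    moreover have fin: "finite (nbrs E z \<inter> B)" using BU by simp
    ultimately have "card (nbrs E z \<inter> B - S) \<le> card (nbrs E z \<inter> B)" by (rule card_mono[rotated])
    then have c2: "card (nbrs E z \<inter> B) = 2" "card (nbrs E z \<inter> B - S) = 2" using * le2[of z] z by auto
    then have "nbrs E z \<inter> B - S = nbrs E z \<inter> B" using card_subset_eq[OF fin sub] by simp
    then show "card (nbrs E z \<inter> (B - S)) = 2" using c2 by (metis Int_Diff)
  qed
  obtain s where s: "s \<in> S" using S by blast
  obtain z0 where z0: "z0 \<in> B - S" using S by blast
  define Z where "Z = component E (B - S) z0"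
  define T where "T = component E (U - Z) s"
  have ZB: "Z \<subseteq> B - S" unfolding Z_def by (rule component_subset[OF z0])
  have sU: "s \<in> U - Z" using s S BU ZB by auto
  have TU: "T \<subseteq> U - Z" unfolding T_def by (rule component_subset[OF sU])
  have sT: "s \<in> T" unfolding T_def by simp
  \<comment> \<open>If no vertex of Z - K were joined to \<open>T\<close>, then \<open>T\<close>
    would be closed under the edges of the connected set U - K and would contain it, including the
    rest of \<open>Z\<close>.\<close>
  have att: "\<exists>q\<in>Z - K. joined E {q} T" if K: "conn E (U - K)" "K \<subseteq> Z" "K \<noteq> Z" for K
  proof (rule ccontr)
    assume no: "\<not> ?thesis"
    have "U - K \<subseteq> T"
    proof (rule conn_closed[OF K(1), of s])
      fix u v assume u: "u \<in> T" and v: "v \<in> U - K" "{u, v} \<in> E"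
      have "v \<notin> Z"
      proof
        assume "v \<in> Z"
        moreover have "joined E {v} T" using u v unfolding joined_def by (auto simp: insert_commute intro!: bexI[of _ u])
        ultimately show False using no v by blast
      qed
      then show "v \<in> T" using u v TU component_closed[of u E "U - Z" s v] unfolding T_def by blast
    qed (use sU K sT in auto)
    then show False using TU K ZB BU by blast
  qed
  obtain r where r: "r \<in> Z" "joined E {r} T"
  proof -
    have "z0 \<in> Z" unfolding Z_def by simp
    then show ?thesis using that att[of "{}"] conU by auto
  qed
  have "finite (B - S)" using BU by simp
  then obtain f :: "nat \<Rightarrow> 'v" and k where k: "2 \<le> k" and f: "f 0 = r" "inj_on f {0..k}" "f ` {0..k} \<subseteq> B - S"
    "\<And>i. i < k \<Longrightarrow> {f i, f (Suc i)} \<in> E" "{f k, f 0} \<in> E"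
    "\<And>v. v \<in> f ` {0..k} \<Longrightarrow> nbrs E v \<inter> (B - S) \<subseteq> f ` {0..k}"
    using two_regular_cycle[of "B - S" r] r ZB two by (smt (verit, best) subsetD)
  have eq: "f i = f j \<longleftrightarrow> i = j" if "i \<le> k" "j \<le> k" for i j
    using inj_on_eq_iff[OF f(2)] that by auto
  have Zf: "Z = f ` {0..k}"
  proof
    show "Z \<subseteq> f ` {0..k}"
    proof (rule conn_closed[of E Z r])
      show "conn E Z" unfolding Z_def by (rule conn_component[OF z0])
      show "r \<in> f ` {0..k}" using f(1) by auto
      show "v \<in> f ` {0..k}" if "u \<in> f ` {0..k}" "v \<in> Z" "{u, v} \<in> E" for u v
        using f(6)[OF that(1)] that ZB unfolding nbrs_def by blast
    qed (use r in simp)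
    show "f ` {0..k} \<subseteq> Z"
    proof (rule conn_closed[of E _ r])
      show "conn E (f ` {0..k})" by (rule conn_segment) (use f in auto)
      show "v \<in> Z" if "u \<in> Z" "u \<in> f ` {0..k}" "v \<in> f ` {0..k}" "{u, v} \<in> E" for u v
        using that component_closed[of u E "B - S" z0 v] f(3) unfolding Z_def by blast
    qed (use r f(1) in auto)
  qed
  have fB: "f i \<in> B" "f i \<notin> X" "f i \<notin> T" "f i \<in> V" if "i \<le> k" for i
  proof -
    have "f i \<in> Z" using that unfolding Zf by simp
    then show "f i \<in> B" "f i \<notin> X" "f i \<notin> T" "f i \<in> V" using ZB BU TU UX by auto
  qed
  have seg: "conn E (f ` {i..j})" if "i \<le> j" "j \<le> k" for i j
    by (rule conn_segment) (use that f(4) in auto)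
  have TX: "T \<inter> X = {}" "T \<subseteq> V" using TU UX by blast+
  have Tc: "conn E T" unfolding T_def by (rule conn_component[OF sU])
  have jTX: "joined E T X" using joined_mono[OF jX, of s T X] s S sT by blast
  \<comment> \<open>An attachment not adjacent to \<open>f 0\<close> on the cycle splits the cycle
    into two nonempty segments. Then \<open>f 0\<close>, \<open>f i\<close>, \<open>X\<close>
    against the two segments and \<open>T\<close> form a K(3,3); segments are joined to
    \<open>X\<close> as they consist of boundary vertices.\<close>
  have mid: False if i: "2 \<le> i" "i < k" and ji: "joined E {f i} T" for i
  proof (rule no_K33[of "f 0" "f i" X "f ` {1..i - 1}" "f ` {Suc i..k}" T])
    show "joined E {f 0} (f ` {1..i - 1})" "joined E {f i} (f ` {1..i - 1})"
      "joined E {f 0} (f ` {Suc i..k})" "joined E {f i} (f ` {Suc i..k})"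
    proof -
      have "{f 0, f 1} \<in> E" "{f i, f (i - 1)} \<in> E" "{f i, f (Suc i)} \<in> E" "{f 0, f k} \<in> E"
        using f(4)[of 0] f(4)[of "i - 1"] f(4)[of i] f(5) i k by (auto simp: insert_commute)
      moreover have "f 1 \<in> f ` {1..i - 1}" "f (i - 1) \<in> f ` {1..i - 1}" "f (Suc i) \<in> f ` {Suc i..k}" "f k \<in> f ` {Suc i..k}"
        using i by auto
      ultimately show "joined E {f 0} (f ` {1..i - 1})" "joined E {f i} (f ` {1..i - 1})"
        "joined E {f 0} (f ` {Suc i..k})" "joined E {f i} (f ` {Suc i..k})"
        unfolding joined_def by blast+
    qed
    show "joined E X (f ` {1..i - 1})" "joined E X (f ` {Suc i..k})"
      unfolding joined_sym[of E X]
      by (rule joined_mono[OF jX[OF fB(1)], of 1 _ X], use i k in auto)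
        (rule joined_mono[OF jX[OF fB(1)], of k _ X], use i k in auto)
    show "f ` {1..i - 1} \<inter> f ` {Suc i..k} = {}" using eq i by auto
    show "f 0 \<noteq> f i" using eq i by auto
    show "f 0 \<notin> X \<union> f ` {1..i - 1} \<union> f ` {Suc i..k} \<union> T" "f i \<notin> X \<union> f ` {1..i - 1} \<union> f ` {Suc i..k} \<union> T"
      using eq i fB by auto
    show "insert (f 0) (insert (f i) (X \<union> f ` {1..i - 1} \<union> f ` {Suc i..k} \<union> T)) \<subseteq> V"
      using fB(4) i UX TX by auto
    show "X \<inter> f ` {1..i - 1} = {}" "X \<inter> f ` {Suc i..k} = {}" "f ` {1..i - 1} \<inter> T = {}" "f ` {Suc i..k} \<inter> T = {}"
      using fB(2,3) i by auto
    show "X \<inter> T = {}" "joined E X T" using TX jTX joined_sym[of E X T] by auto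
    show "conn E (f ` {1..i - 1})" "conn E (f ` {Suc i..k})" using seg i by auto
    show "joined E {f 0} T" using r f by simp
  qed (use i UX Tc ji in auto)
  have end_att: "i = 1 \<or> i = k" if "0 < i" "i \<le> k" "joined E {f i} T" for i
    using mid[of i] that by (cases "i = 1 \<or> i = k") auto
  have "f 1 \<in> f ` {0..k}" using k by auto
  moreover have "f 1 \<notin> {f 0}" using eq[of 1 0] k by simp
  ultimately have f0Z: "{f 0} \<noteq> f ` {0..k}" by metis
  \<comment> \<open>Deleting \<open>f 0\<close> leaves \<open>U\<close> connected, so
    \<open>T\<close> has a second attachment on the cycle.\<close>
  then obtain i where i: "0 < i" "i \<le> k" "joined E {f i} T"
  proof -
    obtain q where "q \<in> f ` {0..k} - {f 0}" "joined E {q} T"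
      using att[of "{f 0}"] vert[OF fB(1)[of 0]] f0Z unfolding Zf by auto
    moreover from this obtain i where "i \<le> k" "q = f i" by auto
    ultimately show ?thesis using that[of i] by (cases "i = 0") auto
  qed
  have i': "i = 1 \<or> i = k" using end_att i by blast
  \<comment> \<open>As the second attachment is next to \<open>f 0\<close>, the pair is a boundary
    edge and may be deleted too; this yields a third attachment, so that \<open>T\<close> is joined
    to \<open>f 0\<close> and to both of its cycle neighbours.\<close>
  then have "{f 0, f i} \<in> E" using f(4)[of 0] f(5) k by (auto simp: insert_commute)
  then have "conn E (U - {f 0, f i})" using edge fB(1) i by blast
  moreover have "{f 0, f i} \<noteq> f ` {0..k}"
  proof
    assume "{f 0, f i} = f ` {0..k}"
    then have "f 1 \<in> {f 0, f i}" "f k \<in> {f 0, f i}" using k by (metis atLeastAtMost_iff image_eqI le0 le_trans one_le_numeral order_refl)+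
    then show False using eq[of 1 0] eq[of 1 i] eq[of k 0] eq[of k i] i k by auto
  qed
  ultimately obtain j where j: "0 < j" "j \<le> k" "j \<noteq> i" "joined E {f j} T"
  proof -
    assume "conn E (U - {f 0, f i})" "{f 0, f i} \<noteq> f ` {0..k}"
    moreover have "{f 0, f i} \<subseteq> f ` {0..k}" using i by auto
    ultimately obtain q where "q \<in> f ` {0..k} - {f 0, f i}" "joined E {q} T"
      using att[of "{f 0, f i}"] unfolding Zf by blast
    moreover from this obtain j where "j \<le> k" "q = f j" by auto
    ultimately show ?thesis using that[of j] by (cases "j = 0"; cases "j = i") auto
  qed
  have j': "j = 1 \<or> j = k" using end_att j by blast
  have j1k: "joined E {f 1} T" "joined E {f k} T" using i i' j j' k by auto
  show False
  \<comment> \<open>Two sides of the triangle are cycle edges at \<open>f 0\<close>, the third is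
    the rest of the cycle.\<close>
  proof (rule no_K5[of "{f 0, f 1}" "f ` {1..k}" "{f k, f 0}" T X "f 0" "f 1" "f k"])
    show "{f 0, f 1} \<inter> f ` {1..k} = {f 1}" "f ` {1..k} \<inter> {f k, f 0} = {f k}" "{f k, f 0} \<inter> {f 0, f 1} = {f 0}"
      "f 0 \<noteq> f 1" "f 1 \<noteq> f k" "f 0 \<noteq> f k"
      using eq k by auto
    show "{f 0, f 1} \<union> f ` {1..k} \<union> {f k, f 0} \<union> T \<union> X \<subseteq> V" using fB(4) k UX TX by auto
    show "X \<inter> ({f 0, f 1} \<union> f ` {1..k} \<union> {f k, f 0}) = {}" using fB(2) k by auto
    show "T \<inter> ({f 0, f 1} \<union> f ` {1..k} \<union> {f k, f 0}) = {}" using fB(3) k by auto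
    show "conn E {f 0, f 1}" "conn E {f k, f 0}" "conn E (f ` {1..k})"
      using conn_edge f(4)[of 0] f(5) seg[of 1 k] k by auto
    show "joined E {f 0} X" "joined E {f 1} X" "joined E {f k} X" using jX fB(1) k by auto
    show "joined E {f 0} T" using r f by simp
  qed (use j1k TX jTX Tc UX k in auto)
qed

end

subsection \<open>Coefficients of graph polynomials\<close>

abbreviation "lookup \<equiv> Poly_Mapping.lookup"

abbreviation "keys \<equiv> Poly_Mapping.keys"

text \<open>Only one pair of exponents contributes to the coefficient: the hypothesis fixes the
  first exponent, and cancellation in the exponent monoid fixes the second.\<close>

lemma lookup_mult_unique:
  fixes f g :: "('a :: cancel_comm_monoid_add) \<Rightarrow>\<^sub>0 'b :: semiring_0"
  assumes uniq: "\<And>a b. lookup f a \<noteq> 0 \<Longrightarrow> lookup g b \<noteq> 0 \<Longrightarrow> a + b = \<alpha> + \<beta> \<Longrightarrow> a = \<alpha>"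
  shows "lookup (f * g) (\<alpha> + \<beta>) = lookup f \<alpha> * lookup g \<beta>"
proof -
  have "lookup f l * Sum_any (\<lambda>q. lookup g q when \<alpha> + \<beta> = l + q) = (lookup f l * lookup g \<beta> when l = \<alpha>)" for l
  proof (cases "l = \<alpha>")
    case True
    have "Sum_any (\<lambda>q. lookup g q when \<alpha> + \<beta> = \<alpha> + q) = lookup g \<beta>" by simp
    then show ?thesis using True by simp
  next
    case False
    have "lookup g q = 0" if "lookup f l \<noteq> 0" "\<alpha> + \<beta> = l + q" for q
      using uniq[of l q] that False by metis
    then have "lookup f l \<noteq> 0 \<Longrightarrow> (lookup g q when \<alpha> + \<beta> = l + q) = 0" for q
      by (auto simp: when_def)
    then show ?thesis using False by (cases "lookup f l = 0") simp_all
  qed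
  then show ?thesis by (simp add: lookup_mult)
qed

lemma lookup_mult_nonzeroE:
  fixes f g :: "('a :: monoid_add) \<Rightarrow>\<^sub>0 'b :: semiring_0"
  assumes "lookup (f * g) \<mu> \<noteq> 0"
  obtains \<alpha> \<beta> where "lookup f \<alpha> \<noteq> 0" "lookup g \<beta> \<noteq> 0" "\<mu> = \<alpha> + \<beta>"
proof -
  have "\<mu> \<in> keys (f * g)" using assms by (simp add: in_keys_iff)
  then show ?thesis using keys_mult[of f g] that by (auto simp: in_keys_iff)
qed

locale ordered_vertices =
  fixes V :: "'v set" and r :: "'v rel"
  assumes fin: "finite V" and lin: "linear_order_on V r"
begin

lemma simple_graph_subset: "simple_graph V F \<Longrightarrow> F' \<subseteq> F \<Longrightarrow> simple_graph V F'"
  unfolding simple_graph_def by blast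

text \<open>\<open>prod\<close> over an infinite set is 1; finiteness licenses splitting the product
  in \<open>graph_poly\<close>.\<close>

lemma finite_pairs:
  assumes "simple_graph V F"
  shows "finite {(u, v). {u, v} \<in> F \<and> (u, v) \<in> r \<and> u \<noteq> v}"
proof (rule finite_subset)
  show "{(u, v). {u, v} \<in> F \<and> (u, v) \<in> r \<and> u \<noteq> v} \<subseteq> V \<times> V"
    using assms unfolding simple_graph_def by auto
qed (simp add: fin)

lemma graph_poly_Un:
  assumes "simple_graph V F" "simple_graph V G" "F \<inter> G = {}"
  shows "graph_poly r (F \<union> G) = graph_poly r F * graph_poly r G"
proof -
  let ?S = "\<lambda>F. {(u, v). {u, v} \<in> F \<and> (u, v) \<in> r \<and> u \<noteq> v}"
  have "?S (F \<union> G) = ?S F \<union> ?S G" "?S F \<inter> ?S G = {}" using assms(3) by auto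
  then show ?thesis
    unfolding graph_poly_def using finite_pairs assms by (metis (no_types, lifting) prod.union_disjoint)
qed

lemma graph_poly_empty [simp]: "graph_poly r {} = 1"
  unfolding graph_poly_def by simp

lemma graph_poly_edge:
  assumes "a \<in> V" "b \<in> V" "a \<noteq> b"
  shows "graph_poly r {{a, b}} = pvar b - pvar a \<or> graph_poly r {{a, b}} = pvar a - pvar b"
proof -
  have anti: "(a, b) \<in> r \<Longrightarrow> (b, a) \<notin> r" and tot: "(a, b) \<in> r \<or> (b, a) \<in> r"
    using lin assms unfolding linear_order_on_def partial_order_on_def antisym_def total_on_def by auto
  have "{(u, v). {u, v} \<in> {{a, b}} \<and> (u, v) \<in> r \<and> u \<noteq> v} = (if (a, b) \<in> r then {(a, b)} else {(b, a)})"
    using anti tot assms(3) by (auto simp: doubleton_eq_iff)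
  then show ?thesis unfolding graph_poly_def by auto
qed

lemma lookup_graph_poly_edge:
  assumes "a \<in> V" "b \<in> V" "a \<noteq> b"
  shows "lookup (graph_poly r {{a, b}}) \<alpha> \<noteq> 0 \<longleftrightarrow> \<alpha> = Poly_Mapping.single a 1 \<or> \<alpha> = Poly_Mapping.single b 1"
proof -
  have "Poly_Mapping.single a (1::nat) \<noteq> Poly_Mapping.single b 1"
    using assms(3) by (metis lookup_single_eq lookup_single_not_eq zero_neq_one)
  then show ?thesis
    using graph_poly_edge[OF assms] by (auto simp: pvar_def lookup_minus lookup_single when_def split: if_splits)
qed

text \<open>Homogeneity; it later turns a pointwise inequality of exponents into an
  equality.\<close>

lemma graph_poly_degree:
  assumes "simple_graph V F" "lookup (graph_poly r F) \<beta> \<noteq> 0"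
  shows "keys \<beta> \<subseteq> \<Union>F \<and> (\<Sum>v\<in>V. lookup \<beta> v) = card F"
proof -
  have "F \<subseteq> Pow V" using assms unfolding simple_graph_def by auto
  then have "finite F" using fin by (simp add: finite_subset)
  then show ?thesis using assms
  proof (induction F arbitrary: \<beta> rule: finite_induct)
    case empty
    then have "\<beta> = 0" by (simp add: lookup_one when_def split: if_splits)
    then show ?case by simp
  next
    case (insert e F)
    have sub: "simple_graph V F" "simple_graph V {e}" using insert.prems(1) by (auto intro: simple_graph_subset)
    obtain a b where ab: "e = {a, b}" "a \<in> V" "b \<in> V" "a \<noteq> b"
      using insert.prems(1) unfolding simple_graph_def by (metis card_2_iff insert_subset insertI1)
    have "graph_poly r (insert e F) = graph_poly r {e} * graph_poly r F"
      using graph_poly_Un[OF sub(2,1)] insert.hyps by simp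
    then obtain \<alpha> \<gamma> where *: "lookup (graph_poly r {e}) \<alpha> \<noteq> 0" "lookup (graph_poly r F) \<gamma> \<noteq> 0" "\<beta> = \<alpha> + \<gamma>"
      using insert.prems(2) by (metis lookup_mult_nonzeroE)
    obtain x where x: "x \<in> e" "x \<in> V" "\<alpha> = Poly_Mapping.single x 1" using * ab lookup_graph_poly_edge by auto
    have IH: "keys \<gamma> \<subseteq> \<Union>F" "(\<Sum>v\<in>V. lookup \<gamma> v) = card F" using insert.IH[OF sub(1) *(2)] by auto
    have "(\<Sum>v\<in>V. lookup \<alpha> v) = 1" using x fin by (simp add: lookup_single when_def)
    then have "(\<Sum>v\<in>V. lookup \<beta> v) = card (insert e F)"
      using IH(2) insert.hyps *(3) by (simp add: lookup_add sum.distrib)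
    moreover have "keys \<beta> \<subseteq> keys \<alpha> \<union> keys \<gamma>" using *(3) by (simp add: keys_add)
    ultimately show ?case using IH(1) x by auto
  qed
qed

text \<open>Let \<open>a\<close> and \<open>b\<close> be exponents with the same sum. Off
  \<open>U\<close> only the second factor contributes, so \<open>b\<close> agrees with
  \<open>\<theta>\<close> there; on \<open>U\<close> it is at least \<open>\<theta>\<close>, which
  is 0. As both have the same total degree, they are equal.\<close>

lemma graph_poly_glue:
  assumes F: "simple_graph V F" "simple_graph V G" "F \<inter> G = {}"
    and UW: "\<Union>F \<subseteq> U" "\<Union>G \<subseteq> W"
    and nz: "lookup (graph_poly r F) \<eta> \<noteq> 0" "lookup (graph_poly r G) \<theta> \<noteq> 0"
    and zero: "\<And>v. v \<in> U \<inter> W \<Longrightarrow> lookup \<theta> v = 0"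
  shows "lookup (graph_poly r (F \<union> G)) (\<eta> + \<theta>) \<noteq> 0"
proof -
  have nonV: "lookup b v = 0" if "lookup (graph_poly r H) b \<noteq> 0" "simple_graph V H" "v \<notin> \<Union>H" for H b v
    using graph_poly_degree[OF that(2,1)] that(3) by (auto simp: in_keys_iff)
  have "lookup (graph_poly r F * graph_poly r G) (\<eta> + \<theta>) = lookup (graph_poly r F) \<eta> * lookup (graph_poly r G) \<theta>"
  proof (rule lookup_mult_unique)
    fix a b assume a: "lookup (graph_poly r F) a \<noteq> 0" and b: "lookup (graph_poly r G) b \<noteq> 0" and eq: "a + b = \<eta> + \<theta>"
    have eqv: "lookup a v + lookup b v = lookup \<eta> v + lookup \<theta> v" for v using eq by (metis lookup_add)
    have ge: "lookup \<theta> v \<le> lookup b v" for v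
    proof (cases "v \<in> U")
      case True
      then have "lookup \<theta> v = 0" using zero[of v] nonV[OF nz(2) F(2), of v] UW by blast
      then show ?thesis by simp
    next
      case False
      then show ?thesis using eqv[of v] nonV[OF nz(1) F(1), of v] nonV[OF a F(1), of v] UW by force
    qed
    have "lookup b v = lookup \<theta> v" for v
    proof (cases "v \<in> V")
      case True
      have "(\<Sum>v\<in>V. lookup \<theta> v) = (\<Sum>v\<in>V. lookup b v)"
        using graph_poly_degree[OF F(2) b] graph_poly_degree[OF F(2) nz(2)] by simp
      then show ?thesis using sum_mono_inv[of "lookup \<theta>" V "lookup b"] ge fin True by metis
    next
      case False
      then have "v \<notin> \<Union>G" using F(2) unfolding simple_graph_def by blast
      then show ?thesis using nonV[OF b F(2)] nonV[OF nz(2) F(2)] by simp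
    qed
    then have "b = \<theta>" by (rule poly_mapping_eqI)
    then show "a = \<eta>" using eq by simp
  qed
  then show ?thesis using nz graph_poly_Un[OF F] by simp
qed

section \<open>Stars: the factors of the edges at one vertex\<close>

definition star :: "'v \<Rightarrow> 'v set \<Rightarrow> 'v set set" where
  "star z N = (\<lambda>u. {z, u}) ` N"

\<comment> \<open>The monomial obtained by choosing z in the factors of the edges to J and the other end in the remaining ones.\<close>
definition star_exp :: "'v \<Rightarrow> 'v set \<Rightarrow> 'v set \<Rightarrow> 'v \<Rightarrow>\<^sub>0 nat" where
  "star_exp z N J = (\<Sum>u\<in>N - J. Poly_Mapping.single u 1) + Poly_Mapping.single z (card J)"

lemma lookup_star_exp:
  assumes "finite N" "z \<notin> N"
  shows "lookup (star_exp z N J) v = (if v = z then card J else if v \<in> N - J then 1 else 0)"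
  using assms by (auto simp: star_exp_def lookup_add lookup_sum lookup_single when_def)

lemma simple_star: "insert z N \<subseteq> V \<Longrightarrow> z \<notin> N \<Longrightarrow> simple_graph V (star z N)"
  unfolding simple_graph_def star_def using fin by (auto simp: card_2_iff)

lemma graph_poly_star_insert:
  assumes "insert z (insert u N) \<subseteq> V" "z \<notin> insert u N" "u \<notin> N"
  shows "graph_poly r (star z (insert u N)) = graph_poly r {{z, u}} * graph_poly r (star z N)"
proof -
  have "star z (insert u N) = {{z, u}} \<union> star z N" unfolding star_def by auto
  moreover have "{{z, u}} \<inter> star z N = {}" using assms unfolding star_def by (auto simp: doubleton_eq_iff)
  moreover have "simple_graph V {{z, u}}" using simple_star[of z "{u}"] assms unfolding star_def by simp
  moreover have "simple_graph V (star z N)" using simple_star[of z N] assms by auto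
  ultimately show ?thesis using graph_poly_Un[of "{{z, u}}" "star z N"] by metis
qed

lemma star_support:
  assumes "insert z N \<subseteq> V" "z \<notin> N" "lookup (graph_poly r (star z N)) \<beta> \<noteq> 0"
  shows "\<exists>J\<subseteq>N. \<beta> = star_exp z N J"
proof -
  have "finite N" using assms(1) finite_subset[OF _ fin, of N] by simp
  then show ?thesis using assms
  proof (induction N arbitrary: \<beta> rule: finite_induct)
    case empty
    then have "\<beta> = 0" by (simp add: star_def lookup_one when_def split: if_splits)
    then show ?case by (simp add: star_exp_def)
  next
    case (insert u N)
    have zu: "z \<noteq> u" "z \<in> V" "u \<in> V" using insert.prems by auto
    obtain \<alpha> \<gamma> where *: "lookup (graph_poly r {{z, u}}) \<alpha> \<noteq> 0" "lookup (graph_poly r (star z N)) \<gamma> \<noteq> 0" "\<beta> = \<alpha> + \<gamma>"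
      using graph_poly_star_insert[OF insert.prems(1,2) insert.hyps(2)] insert.prems(3) by (metis lookup_mult_nonzeroE)
    obtain J where J: "J \<subseteq> N" "\<gamma> = star_exp z N J" using insert.IH[OF _ _ *(2)] insert.prems by auto
    have finJ: "finite J" using finite_subset[OF J(1) insert.hyps(1)] .
    have uJ: "u \<notin> J" "z \<notin> J" using J(1) insert.hyps(2) insert.prems(2) by auto
    consider "\<alpha> = Poly_Mapping.single z 1" | "\<alpha> = Poly_Mapping.single u 1"
      using * lookup_graph_poly_edge[OF zu(2,3,1)] by blast
    then show ?case
    proof cases
      case 1
      have "\<beta> = star_exp z (insert u N) (insert u J)"
        by (rule poly_mapping_eqI)
          (use J *(3) 1 insert.hyps insert.prems(2) finJ uJ zu in \<open>auto simp: lookup_star_exp lookup_add lookup_single when_def\<close>)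
      then show ?thesis using J by blast
    next
      case 2
      have "\<beta> = star_exp z (insert u N) J"
        by (rule poly_mapping_eqI)
          (use J *(3) 2 insert.hyps insert.prems(2) finJ uJ zu in \<open>auto simp: lookup_star_exp lookup_add lookup_single when_def\<close>)
      then show ?thesis using J by blast
    qed
  qed
qed

text \<open>A star is a forest, so different choices give different monomials: the exponent at a
  leaf \<open>u\<close> tells which end was chosen in the factor of its edge.\<close>

lemma star_nonzero:
  assumes "insert z N \<subseteq> V" "z \<notin> N" "J \<subseteq> N"
  shows "lookup (graph_poly r (star z N)) (star_exp z N J) \<noteq> 0"
proof -
  have "finite N" using assms(1) finite_subset[OF _ fin, of N] by simp
  then show ?thesis using assms
  proof (induction N arbitrary: J rule: finite_induct)
    case empty
    then show ?case by (simp add: star_def star_exp_def)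
  next
    case (insert u N)
    have zu: "z \<noteq> u" "z \<in> V" "u \<in> V" and zN: "insert z N \<subseteq> V" "z \<notin> N" using insert.prems by auto
    have finJ: "finite J" using insert.prems(3) insert.hyps(1) by (meson finite_insert finite_subset)
    define x where "x = (if u \<in> J then z else u)"
    have split: "star_exp z (insert u N) J = Poly_Mapping.single x 1 + star_exp z N (J - {u})"
    proof (rule poly_mapping_eqI)
      have "u \<in> J \<Longrightarrow> card J = Suc (card (J - {u}))" using finJ by (metis card.remove)
      then show "lookup (star_exp z (insert u N) J) v = lookup (Poly_Mapping.single x 1 + star_exp z N (J - {u})) v" for v
        using insert.hyps zu zN by (auto simp: lookup_star_exp lookup_add lookup_single when_def x_def)
    qed
    have "lookup (graph_poly r {{z, u}} * graph_poly r (star z N)) (star_exp z (insert u N) J)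
        = lookup (graph_poly r {{z, u}}) (Poly_Mapping.single x 1) * lookup (graph_poly r (star z N)) (star_exp z N (J - {u}))"
      unfolding split
    proof (rule lookup_mult_unique)
      fix a b assume a: "lookup (graph_poly r {{z, u}}) a \<noteq> 0" and b: "lookup (graph_poly r (star z N)) b \<noteq> 0"
        and eq: "a + b = Poly_Mapping.single x 1 + star_exp z N (J - {u})"
      obtain J' where J': "b = star_exp z N J'" using star_support[OF zN b] by blast
      have "lookup a u + lookup b u = lookup (Poly_Mapping.single x 1) u + lookup (star_exp z N (J - {u})) u"
        using eq by (metis lookup_add)
      then have "lookup a u = lookup (Poly_Mapping.single x 1) u"
        unfolding J' using insert.hyps zu zN by (simp add: lookup_star_exp)
      moreover have "a = Poly_Mapping.single z 1 \<or> a = Poly_Mapping.single u 1"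
        using a lookup_graph_poly_edge[OF zu(2,3,1)] by blast
      ultimately show "a = Poly_Mapping.single x 1"
        unfolding x_def using zu(1) by (auto simp: lookup_single when_def split: if_splits)
    qed
    moreover have "lookup (graph_poly r {{z, u}}) (Poly_Mapping.single x 1) \<noteq> 0"
      using lookup_graph_poly_edge[OF zu(2,3,1)] unfolding x_def by simp
    moreover have "lookup (graph_poly r (star z N)) (star_exp z N (J - {u})) \<noteq> 0"
      by (rule insert.IH[OF zN]) (use insert.prems(3) in auto)
    ultimately show ?case
      using graph_poly_star_insert[OF insert.prems(1,2) insert.hyps(2)] by simp
  qed
qed

text \<open>In another contribution with choice set \<open>J'\<close>, exponent 0 at the vertices of
  \<open>J\<close> forces \<open>J\<close> into \<open>J'\<close>. Only the star supplies the
  variable of \<open>z\<close>, so the two sets have the same size and coincide.\<close>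

lemma star_mult_nonzero:
  assumes N: "insert z N \<subseteq> V" "z \<notin> N" "J \<subseteq> N"
    and free: "\<And>\<alpha>. lookup P \<alpha> \<noteq> 0 \<Longrightarrow> lookup \<alpha> z = 0"
    and \<eta>: "lookup P \<eta> \<noteq> 0" "\<And>u. u \<in> J \<Longrightarrow> lookup \<eta> u = 0"
  shows "lookup (P * graph_poly r (star z N)) (\<eta> + star_exp z N J) \<noteq> 0"
proof -
  have finN: "finite N" using N(1) finite_subset[OF _ fin, of N] by simp
  have "lookup (P * graph_poly r (star z N)) (\<eta> + star_exp z N J)
      = lookup P \<eta> * lookup (graph_poly r (star z N)) (star_exp z N J)"
  proof (rule lookup_mult_unique)
    fix a b assume a: "lookup P a \<noteq> 0" and b: "lookup (graph_poly r (star z N)) b \<noteq> 0" and eq: "a + b = \<eta> + star_exp z N J"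
    obtain J' where J': "J' \<subseteq> N" "b = star_exp z N J'" using star_support[OF N(1,2) b] by blast
    have eqv: "lookup a v + lookup b v = lookup \<eta> v + lookup (star_exp z N J) v" for v using eq by (metis lookup_add)
    have "J \<subseteq> J'"
    proof
      fix u assume u: "u \<in> J"
      then have "u \<noteq> z" "u \<in> N" using N by auto
      then have "lookup b u = 0" using eqv[of u] u \<eta>(2) N finN by (simp add: lookup_star_exp)
      then show "u \<in> J'" using J' N finN \<open>u \<noteq> z\<close> \<open>u \<in> N\<close> by (auto simp: lookup_star_exp split: if_splits)
    qed
    moreover have "card J = card J'"
      using eqv[of z] free[OF a] free[OF \<eta>(1)] J' N finN by (simp add: lookup_star_exp)
    ultimately have "J = J'" using J'(1) finN by (metis card_subset_eq finite_subset)
    then show "a = \<eta>" using eq J' by simp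
  qed
  then show ?thesis using \<eta>(1) star_nonzero[OF N] by simp
qed

text \<open>Split off the factor of the edge zw. A competing contribution takes w there, so
  \<open>z\<close> must come from one more edge of the remaining star. As before its choice set
  contains \<open>J\<close>, hence it is \<open>insert i J\<close>, and comparing exponents shows
  that one unit has moved from \<open>w\<close> to \<open>i\<close>.\<close>

lemma star_mult_alternative:
  assumes N: "insert z N \<subseteq> V" "z \<notin> N" "insert w J \<subseteq> N" "w \<notin> J"
    and free: "\<And>\<alpha>. lookup P \<alpha> \<noteq> 0 \<Longrightarrow> lookup \<alpha> z = 0"
    and \<eta>: "lookup P \<eta> \<noteq> 0" "\<And>u. u \<in> J \<Longrightarrow> lookup \<eta> u = 0"
    and zero: "lookup (P * graph_poly r (star z N)) (\<eta> + star_exp z N (insert w J)) = 0"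
  shows "\<exists>i\<in>N - insert w J. \<exists>\<alpha>. lookup P \<alpha> \<noteq> 0 \<and> \<alpha> + Poly_Mapping.single w 1 = \<eta> + Poly_Mapping.single i 1"
proof -
  define N' where "N' = N - {w}"
  have N': "insert z N' \<subseteq> V" "z \<notin> N'" "J \<subseteq> N'" "w \<notin> N'" and NN': "N = insert w N'" using N unfolding N'_def by auto
  have finN: "finite N'" using N'(1) finite_subset[OF _ fin, of N'] by simp
  have zw: "z \<noteq> w" "z \<in> V" "w \<in> V" using N by auto
  have finJ: "finite J" using finite_subset[OF N'(3) finN] .
  let ?R = "P * graph_poly r (star z N')" and ?e = "graph_poly r {{z, w}}"
  have prod: "P * graph_poly r (star z N) = ?e * ?R"
    unfolding NN' using graph_poly_star_insert[of z w N'] N' zw by (simp add: ac_simps)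
  have split: "\<eta> + star_exp z N (insert w J) = Poly_Mapping.single z 1 + (\<eta> + star_exp z N' J)"
    by (rule poly_mapping_eqI)
      (use N N' NN' finN finJ in \<open>auto simp: lookup_star_exp lookup_add lookup_single when_def\<close>)
  \<comment> \<open>The intended pair contributes a nonzero product; a vanishing total coefficient
    thus requires a second contributing pair.\<close>
  have "lookup ?e (Poly_Mapping.single z 1) * lookup ?R (\<eta> + star_exp z N' J) \<noteq> 0"
    using lookup_graph_poly_edge[OF zw(2,3,1)] star_mult_nonzero[OF N'(1-3) free \<eta>] by simp
  then have "\<not> (\<forall>a b. lookup ?e a \<noteq> 0 \<longrightarrow> lookup ?R b \<noteq> 0 \<longrightarrow>
      a + b = Poly_Mapping.single z 1 + (\<eta> + star_exp z N' J) \<longrightarrow> a = Poly_Mapping.single z 1)"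
    using zero lookup_mult_unique[of ?e ?R "Poly_Mapping.single z 1" "\<eta> + star_exp z N' J"] unfolding prod split by metis
  then obtain a b where ab: "lookup ?e a \<noteq> 0" "lookup ?R b \<noteq> 0"
    "a + b = Poly_Mapping.single z 1 + (\<eta> + star_exp z N' J)" "a \<noteq> Poly_Mapping.single z 1" by blast
  then have a: "a = Poly_Mapping.single w 1" using lookup_graph_poly_edge[OF zw(2,3,1)] by blast
  obtain \<alpha> \<beta> where \<alpha>: "lookup P \<alpha> \<noteq> 0" and \<beta>: "lookup (graph_poly r (star z N')) \<beta> \<noteq> 0" and b: "b = \<alpha> + \<beta>"
    using ab(2) by (rule lookup_mult_nonzeroE)
  obtain J' where J': "J' \<subseteq> N'" "\<beta> = star_exp z N' J'" using star_support[OF N'(1,2) \<beta>] by blast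
  have eqv: "lookup (Poly_Mapping.single w 1) v + (lookup \<alpha> v + lookup (star_exp z N' J') v)
      = lookup (Poly_Mapping.single z 1) v + (lookup \<eta> v + lookup (star_exp z N' J) v)" for v
    using ab(3) unfolding a b J'(2) by (metis lookup_add)
  have sub: "J \<subseteq> J'"
  proof
    fix u assume u: "u \<in> J"
    then have "u \<noteq> z" "u \<in> N'" using N' by auto
    then show "u \<in> J'" using eqv[of u] u \<eta>(2) N' finN
      by (auto simp: lookup_star_exp lookup_single when_def split: if_splits)
  qed
  have "card J' = Suc (card J)"
    using eqv[of z] free[OF \<alpha>] free[OF \<eta>(1)] N' finN zw by (simp add: lookup_star_exp lookup_single when_def)
  then have "card (J' - J) = 1" using sub finJ by (simp add: card_Diff_subset)
  then obtain i where i: "J' - J = {i}" by (metis card_1_singletonE)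
  then have J'i: "J' = insert i J" "i \<notin> J" using sub by auto
  have iN: "i \<in> N'" "i \<noteq> z" using J'i J' N' by auto
  have "lookup (\<alpha> + Poly_Mapping.single w 1) v = lookup (\<eta> + Poly_Mapping.single i 1) v" for v
    using eqv[of v] free[OF \<alpha>] free[OF \<eta>(1)] iN J'i N' finN finJ zw
    by (auto simp: lookup_star_exp lookup_add lookup_single when_def split: if_splits)
  then have "\<alpha> + Poly_Mapping.single w 1 = \<eta> + Poly_Mapping.single i 1" by (rule poly_mapping_eqI)
  then show ?thesis using \<alpha> iN J'i N' NN' by blast
qed

end

subsection \<open>Nice monomials\<close>

locale ordered_drawing = drawing V E p \<gamma> + ordered_vertices V r
  for V :: "'v set" and E p \<gamma> r
begin

text \<open>Edges inside \<open>S\<close> are left out because any choice in their factors would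
  give an end in \<open>S\<close> a positive exponent.\<close>

definition inner_edges :: "'v set \<Rightarrow> 'v set \<Rightarrow> 'v set set" where
  "inner_edges U S = {e \<in> E. e \<subseteq> U \<and> \<not> e \<subseteq> S}"

text \<open>The bound 2 on \<open>B - S\<close> reserves a unit for a neighbour that is put back
  later. A matching edge is charged like an exponent: a matched vertex of \<open>B - S\<close> has
  exponent at most 1 and can absorb two further units.\<close>

definition nice_for :: "'v set \<Rightarrow> 'v set \<Rightarrow> 'v set \<Rightarrow> 'v set set \<Rightarrow> ('v \<Rightarrow>\<^sub>0 nat) \<Rightarrow> bool" where
  "nice_for U B S M \<eta> \<longleftrightarrow>
     M \<subseteq> E \<and> pairwise disjnt M \<and> (\<forall>e\<in>M. e \<subseteq> U \<and> e \<inter> S = {}) \<and>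
     lookup (graph_poly r (inner_edges U S - M)) \<eta> \<noteq> 0 \<and>
     (\<forall>v\<in>S. lookup \<eta> v = 0) \<and>
     (\<forall>v\<in>B - S. lookup \<eta> v + (if v \<in> \<Union>M then 1 else 0) \<le> 2) \<and>
     (\<forall>v\<in>U. lookup \<eta> v \<le> 3)"

definition nice :: "'v set \<Rightarrow> 'v set \<Rightarrow> 'v set \<Rightarrow> bool" where
  "nice U B S \<longleftrightarrow> (\<exists>M \<eta>. nice_for U B S M \<eta>)"

lemma simple_inner: "simple_graph V (inner_edges U S - M)"
  using simple simple_graph_subset[of E "inner_edges U S - M"] unfolding inner_edges_def by blast

lemma nice_for_support: "nice_for U B S M \<eta> \<Longrightarrow> v \<notin> U \<Longrightarrow> lookup \<eta> v = 0"
  using graph_poly_degree[OF simple_inner, of U S M \<eta>]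
  unfolding nice_for_def by (auto simp: inner_edges_def in_keys_iff)

section \<open>Gluing solutions and releasing a precoloured edge\<close>

lemma nice_whole: "nice S B S" if "B \<subseteq> S"
proof -
  have "inner_edges S S = {}" unfolding inner_edges_def by auto
  then have "nice_for S B S {} 0" using that unfolding nice_for_def by (auto simp: lookup_one)
  then show ?thesis unfolding nice_def by blast
qed

text \<open>The second solution precolours the whole overlap. There it has exponent 0, so the first
  solution alone decides the bounds and products do not cancel; it leaves the overlap unmatched, so
  the matchings are compatible. Edges inside the overlap are accounted for by the first
  solution.\<close>

lemma nice_glue:
  assumes UW: "nice U B1 S" "nice W B2 (U \<inter> W)" and S: "S \<subseteq> U"
    and B: "B \<inter> U \<subseteq> B1" "B \<inter> W \<subseteq> B2"
    and edges: "\<And>e. e \<in> E \<Longrightarrow> e \<subseteq> U \<union> W \<Longrightarrow> e \<subseteq> U \<or> e \<subseteq> W"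
    and BUW: "B \<subseteq> U \<union> W"
  shows "nice (U \<union> W) B S"
proof -
  obtain M \<eta> where M: "nice_for U B1 S M \<eta>" using UW(1) unfolding nice_def by blast
  obtain M' \<theta> where M': "nice_for W B2 (U \<inter> W) M' \<theta>" using UW(2) unfolding nice_def by blast
  note m = M[unfolded nice_for_def] and m' = M'[unfolded nice_for_def]
  have supp: "v \<notin> U \<Longrightarrow> lookup \<eta> v = 0" "v \<notin> W \<Longrightarrow> lookup \<theta> v = 0" for v
    using nice_for_support[OF M] nice_for_support[OF M'] by auto
  have ne: "e \<noteq> {}" if "e \<in> E" for e using edge_card[OF that] by auto
  let ?F = "inner_edges U S - M" and ?G = "inner_edges W (U \<inter> W) - M'"
  have "e \<in> ?F \<union> ?G \<longleftrightarrow> e \<in> inner_edges (U \<union> W) S - (M \<union> M')" for e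
  proof -
    \<comment> \<open>Removing one matching must not delete an edge that the other side has counted:
      an edge of \<open>M'\<close> inside \<open>U\<close> would lie in the overlap, which
      \<open>M'\<close> avoids.\<close>
    have 1: "e \<notin> M'" if "e \<subseteq> U" "e \<in> E"
    proof
      assume "e \<in> M'"
      then have "e \<subseteq> W" "e \<inter> (U \<inter> W) = {}" using m' by auto
      then show False using that ne by blast
    qed
    have 2: "e \<notin> M" if "\<not> e \<subseteq> U" using that m by blast
    show ?thesis
      using edges[of e] 1 2 S unfolding inner_edges_def by blast
  qed
  then have FG: "?F \<union> ?G = inner_edges (U \<union> W) S - (M \<union> M')" by blast
  have disj: "?F \<inter> ?G = {}" unfolding inner_edges_def by auto
  have "lookup (graph_poly r (?F \<union> ?G)) (\<eta> + \<theta>) \<noteq> 0"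
    by (rule graph_poly_glue[OF simple_inner simple_inner disj, of U W])
      (use m m' in \<open>auto simp: inner_edges_def\<close>)
  moreover have "pairwise disjnt (M \<union> M')"
  proof -
    have "disjnt e e'" if "e \<in> M" "e' \<in> M'" for e e'
    proof -
      have "e \<subseteq> U" "e' \<subseteq> W" "e' \<inter> (U \<inter> W) = {}" using that m m' by simp_all
      then show ?thesis unfolding disjnt_def by blast
    qed
    moreover have "pairwise disjnt M" "pairwise disjnt M'" using m m' by simp_all
    ultimately show ?thesis unfolding pairwise_def by (metis Un_iff disjnt_sym)
  qed
  moreover have "\<forall>e\<in>M \<union> M'. e \<subseteq> U \<union> W \<and> e \<inter> S = {}"
  proof
    fix e assume "e \<in> M \<union> M'"
    then have "e \<subseteq> U \<and> e \<inter> S = {} \<or> e \<subseteq> W \<and> e \<inter> (U \<inter> W) = {}" using m m' by auto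
    then show "e \<subseteq> U \<union> W \<and> e \<inter> S = {}" using S by blast
  qed
  moreover have "lookup (\<eta> + \<theta>) v = 0" if "v \<in> S" for v
    using m m' S that supp(2)[of v] by (cases "v \<in> W") (auto simp: lookup_add)
  moreover have "lookup (\<eta> + \<theta>) v + (if v \<in> \<Union>(M \<union> M') then 1 else 0) \<le> 2" if v: "v \<in> B - S" for v
  proof (cases "v \<in> U")
    case True
    have "lookup \<theta> v = 0" using m' True supp(2)[of v] by blast
    moreover have "v \<notin> \<Union>M'" using m' True by blast
    moreover have "v \<in> B1 - S" using v True B by blast
    then have "lookup \<eta> v + (if v \<in> \<Union>M then 1 else 0) \<le> 2" using m by blast
    ultimately show ?thesis by (simp add: lookup_add)
  next
    case False
    have "v \<in> W" using v False BUW by blast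
    have "v \<notin> \<Union>M" using m False by blast
    moreover have "v \<in> B2 - U \<inter> W" using v False B \<open>v \<in> W\<close> by blast
    then have "lookup \<theta> v + (if v \<in> \<Union>M' then 1 else 0) \<le> 2" using m' by blast
    ultimately show ?thesis using supp(1)[OF False] by (simp add: lookup_add)
  qed
  moreover have "lookup (\<eta> + \<theta>) v \<le> 3" if "v \<in> U \<union> W" for v
  proof (cases "v \<in> U")
    case True
    have "lookup \<theta> v = 0" using m' True supp(2)[of v] by blast
    then show ?thesis using m True by (simp add: lookup_add)
  next
    case False
    then show ?thesis using m' that supp(1)[OF False] by (simp add: lookup_add)
  qed
  moreover have "M \<union> M' \<subseteq> E" using m m' by simp
  ultimately have "nice_for (U \<union> W) B S (M \<union> M') (\<eta> + \<theta>)"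
    unfolding nice_for_def FG by (intro conjI ballI) (assumption | blast)+
  then show ?thesis unfolding nice_def by blast
qed

text \<open>The factor of the edge ab returns with the choice \<open>b\<close>. The other choice
  would give \<open>a\<close> a positive exponent, so nothing cancels; \<open>b\<close> then has
  exponent 1 and is unmatched.\<close>

lemma nice_forget_edge:
  assumes nice: "nice U B {a, b}" and ab: "{a, b} \<in> E" "a \<in> U" "b \<in> U"
  shows "nice U B {}"
proof -
  obtain M \<eta> where M: "nice_for U B {a, b} M \<eta>" using nice unfolding nice_def by blast
  note m = M[unfolded nice_for_def]
  let ?F = "inner_edges U {a, b} - M"
  have ne: "a \<noteq> b" and V: "a \<in> V" "b \<in> V" using edge_neq edge_subset ab by auto
  have FM: "inner_edges U {} - M = ?F \<union> {{a, b}}"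
  proof -
    have "e = {a, b}" if "e \<in> E" "e \<subseteq> {a, b}" for e
      using card_subset_eq[of "{a, b}" e] that edge_card ne by auto
    moreover have "{a, b} \<notin> M" using m by blast
    moreover have "e \<noteq> {}" if "e \<in> E" for e using edge_card[OF that] by auto
    ultimately show ?thesis using ab unfolding inner_edges_def by auto
  qed
  have sg: "simple_graph V {{a, b}}" using ab simple simple_graph_subset by blast
  have "?F \<inter> {{a, b}} = {}" unfolding inner_edges_def by auto
  then have prod: "graph_poly r (?F \<union> {{a, b}}) = graph_poly r ?F * graph_poly r {{a, b}}"
    using graph_poly_Un[OF simple_inner sg] by blast
  have zero: "lookup \<eta> a = 0" "lookup \<eta> b = 0" using m by auto
  have "lookup (graph_poly r ?F * graph_poly r {{a, b}}) (\<eta> + Poly_Mapping.single b 1)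
      = lookup (graph_poly r ?F) \<eta> * lookup (graph_poly r {{a, b}}) (Poly_Mapping.single b 1)"
  proof (rule lookup_mult_unique)
    fix \<alpha> \<beta> assume *: "lookup (graph_poly r {{a, b}}) \<beta> \<noteq> 0" "\<alpha> + \<beta> = \<eta> + Poly_Mapping.single b 1"
    have "lookup \<alpha> a + lookup \<beta> a = 0" using arg_cong[OF *(2), of "\<lambda>x. lookup x a"] zero ne
      by (simp add: lookup_add lookup_single when_def)
    then have "\<beta> \<noteq> Poly_Mapping.single a 1" by (auto simp: lookup_single when_def)
    then have "\<beta> = Poly_Mapping.single b 1" using * lookup_graph_poly_edge[OF V ne] by blast
    then show "\<alpha> = \<eta>" using *(2) by simp
  qed
  then have nz: "lookup (graph_poly r (inner_edges U {} - M)) (\<eta> + Poly_Mapping.single b 1) \<noteq> 0"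
    unfolding FM prod using m lookup_graph_poly_edge[OF V ne] by simp
  have un: "a \<notin> \<Union>M" "b \<notin> \<Union>M" using m by auto
  have val: "lookup (\<eta> + Poly_Mapping.single b 1) v = (if v = b then 1 else if v = a then 0 else lookup \<eta> v)" for v
    using zero by (auto simp: lookup_add lookup_single when_def)
  have "nice_for U B {} M (\<eta> + Poly_Mapping.single b 1)"
    unfolding nice_for_def
  proof (intro conjI ballI)
    show "lookup (\<eta> + Poly_Mapping.single b 1) v + (if v \<in> \<Union>M then 1 else 0) \<le> 2" if v: "v \<in> B - {}" for v
    proof (cases "v \<in> {a, b}")
      case True then show ?thesis unfolding val using un by auto
    next
      case False
      then have "lookup \<eta> v + (if v \<in> \<Union>M then 1 else 0) \<le> 2" using m v by simp
      then show ?thesis unfolding val using False by simp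
    qed
    show "lookup (\<eta> + Poly_Mapping.single b 1) v \<le> 3" if "v \<in> U" for v
      unfolding val using m that by simp
  qed (use nz m in simp_all)
  then show ?thesis unfolding nice_def by blast
qed

section \<open>Putting one vertex back\<close>

lemma inner_edges_insert:
  assumes z: "z \<in> V" "z \<notin> U" and M: "\<And>e. e \<in> M \<Longrightarrow> e \<subseteq> U"
  shows "inner_edges (insert z U) S - M =
    (inner_edges U (S - {z}) - M) \<union> star z (if z \<in> S then nbrs E z \<inter> U - S else nbrs E z \<inter> U)"
proof -
  have star: "{e \<in> E. z \<in> e \<and> e \<subseteq> insert z U} = star z (nbrs E z \<inter> U)"
  proof
    show "{e \<in> E. z \<in> e \<and> e \<subseteq> insert z U} \<subseteq> star z (nbrs E z \<inter> U)"
    proof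
      fix e assume e: "e \<in> {e \<in> E. z \<in> e \<and> e \<subseteq> insert z U}"
      then obtain x y where xy: "e = {x, y}" "x \<noteq> y" using edge_card by (metis (no_types, lifting) card_2_iff mem_Collect_eq)
      define u where "u = (if x = z then y else x)"
      have "e = {z, u}" "u \<noteq> z" using xy e unfolding u_def by auto
      then show "e \<in> star z (nbrs E z \<inter> U)" using e unfolding star_def nbrs_def by auto
    qed
    show "star z (nbrs E z \<inter> U) \<subseteq> {e \<in> E. z \<in> e \<and> e \<subseteq> insert z U}" unfolding star_def nbrs_def by auto
  qed
  have "inner_edges (insert z U) S - M = (inner_edges U (S - {z}) - M) \<union> {e \<in> star z (nbrs E z \<inter> U). \<not> e \<subseteq> S}"
    unfolding star[symmetric] inner_edges_def using z(2) M by auto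
  moreover have "{e \<in> star z (nbrs E z \<inter> U). \<not> e \<subseteq> S} = star z (if z \<in> S then nbrs E z \<inter> U - S else nbrs E z \<inter> U)"
    unfolding star_def by auto
  ultimately show ?thesis by simp
qed

lemma graph_poly_inner_insert:
  assumes z: "z \<in> V" "z \<notin> U" "U \<subseteq> V" and N: "N \<subseteq> U"
  shows "graph_poly r ((inner_edges U S - M) \<union> star z N) = graph_poly r (inner_edges U S - M) * graph_poly r (star z N)"
    "lookup (graph_poly r (inner_edges U S - M)) \<alpha> \<noteq> 0 \<Longrightarrow> lookup \<alpha> z = 0"
proof -
  have "simple_graph V (star z N)" using simple_star[of z N] z N by auto
  moreover have "(inner_edges U S - M) \<inter> star z N = {}" unfolding inner_edges_def star_def using z by auto
  ultimately show "graph_poly r ((inner_edges U S - M) \<union> star z N) = graph_poly r (inner_edges U S - M) * graph_poly r (star z N)"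
    using graph_poly_Un[OF simple_inner] by blast
  show "lookup (graph_poly r (inner_edges U S - M)) \<alpha> \<noteq> 0 \<Longrightarrow> lookup \<alpha> z = 0"
    using graph_poly_degree[OF simple_inner, of U S M \<alpha>] z(2) by (auto simp: inner_edges_def in_keys_iff)
qed

text \<open>Here \<open>z\<close> may stay at exponent 0: every edge counted at \<open>z\<close> is
  paid by its other end, which had at most 2. No vertex outside \<open>S\<close> has to keep the
  bound 2, since \<open>B\<close> is contained in \<open>S\<close>. The case S = {} serves vertices
  when the boundary is empty.\<close>

lemma nice_insert_precoloured:
  assumes z: "z \<in> V" "z \<notin> U" "U \<subseteq> V" and S: "z \<in> S \<or> S = {}" "S \<subseteq> insert z U" and B: "B \<subseteq> S"
    and nice: "nice U B' (S - {z})" and B': "nbrs E z \<inter> U \<subseteq> B'"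
  shows "nice (insert z U) B S"
proof -
  obtain M \<eta> where M: "nice_for U B' (S - {z}) M \<eta>" using nice unfolding nice_def by blast
  note m = M[unfolded nice_for_def]
  define N where "N = nbrs E z \<inter> U - S"
  have N: "N \<subseteq> U" "insert z N \<subseteq> V" "z \<notin> N" "finite N" using z finite_subset[OF _ fin, of N] unfolding N_def by auto
  have eq: "inner_edges (insert z U) S - M = (inner_edges U (S - {z}) - M) \<union> star z N"
    using inner_edges_insert[OF z(1,2), of M S] m S(1) unfolding N_def by auto
  note gp = graph_poly_inner_insert[OF z N(1), of "S - {z}" M]
  define \<theta> where "\<theta> = \<eta> + star_exp z N {}"
  have "lookup (graph_poly r (inner_edges (insert z U) S - M)) \<theta> \<noteq> 0"
    unfolding eq gp(1) \<theta>_def by (rule star_mult_nonzero[OF N(2,3) _ gp(2)]) (use m in auto)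
  moreover have val: "lookup \<theta> v = lookup \<eta> v + (if v \<in> N then 1 else 0)" for v
    unfolding \<theta>_def using N by (auto simp: lookup_add lookup_star_exp)
  moreover have "lookup \<eta> z = 0" using nice_for_support[OF M z(2)] .
  moreover have "\<forall>v\<in>S. v \<notin> N" unfolding N_def by blast
  moreover have "lookup \<eta> v \<le> 2" if "v \<in> N" for v
    using m that B' unfolding N_def by (auto dest!: bspec[of _ _ v])
  moreover have "e \<inter> S = {}" if "e \<in> M" for e using m that z(2) by blast
  ultimately have "nice_for (insert z U) B S M \<theta>"
    unfolding nice_for_def using m B N(3) by (auto simp: val)
  then show ?thesis unfolding nice_def by blast
qed

text \<open>Exponents may grow only at \<open>z\<close>, up to 2, and at neighbours outside
  \<open>B\<close>, from at most 2 to 3. So \<open>z\<close> should pay for its edges to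
  \<open>S\<close> and to \<open>w\<close>, at most two in all. If that coefficient vanishes,
  \<open>star_mult_alternative\<close> frees a unit at \<open>w\<close> at the expense of a
  neighbour \<open>i\<close> outside \<open>B\<close>, which then faces two extra units.\<close>

lemma nice_insert_good:
  assumes z: "z \<in> V" "z \<notin> U" "U \<subseteq> V" and S: "S \<subseteq> B" "z \<notin> S" and B: "B \<subseteq> insert z U"
    and nice: "nice U B' S" and B': "nbrs E z \<inter> U \<subseteq> B'" "B - {z} \<subseteq> B'"
    and good: "card (nbrs E z \<inter> B) \<le> 2" "card (nbrs E z \<inter> B - S) \<le> 1"
  shows "nice (insert z U) B S"
proof -
  obtain M \<eta> where M: "nice_for U B' S M \<eta>" using nice unfolding nice_def by blast
  note m = M[unfolded nice_for_def]
  have finB: "finite B" using B z finite_subset[OF _ fin, of B] by auto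
  have zz: "z \<notin> nbrs E z" unfolding nbrs_def using edge_neq by blast
  define N where "N = nbrs E z \<inter> U"
  \<comment> \<open>Vertices of \<open>S\<close> must keep exponent 0, so \<open>z\<close> pays for
    all edges to them.\<close>
  define J where "J = N \<inter> S"
  have N: "N \<subseteq> U" "insert z N \<subseteq> V" "z \<notin> N" "finite N" using z finite_subset[OF _ fin, of N] unfolding N_def by auto
  have NB: "N \<inter> B = nbrs E z \<inter> B" using B zz unfolding N_def by auto
  have J: "J \<subseteq> N" "J \<subseteq> S" "finite J" "J \<subseteq> nbrs E z \<inter> B" using N(4) S NB unfolding J_def by auto
  have eq: "inner_edges (insert z U) S - M = (inner_edges U S - M) \<union> star z N"
    using inner_edges_insert[OF z(1,2), of M S] m S(2) unfolding N_def by auto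
  note gp = graph_poly_inner_insert[OF z N(1), of S M]
  have mE: "M \<subseteq> E" "pairwise disjnt M" "\<forall>e\<in>M. e \<subseteq> insert z U \<and> e \<inter> S = {}"
    using m by auto
  have zM: "z \<notin> \<Union>M" using m z(2) by blast
  have \<eta>z: "lookup \<eta> z = 0" using nice_for_support[OF M z(2)] .
  have \<eta>S: "lookup \<eta> v = 0" if "v \<in> S" for v using m that by blast
  have \<eta>B: "lookup \<eta> v + (if v \<in> \<Union>M then 1 else 0) \<le> 2" if "v \<in> B' - S" for v using m that by blast
  have \<eta>U: "lookup \<eta> v \<le> 3" if "v \<in> U" for v using m that by blast
  have NB': "v \<in> B' - S" if "v \<in> N - J" for v using that B'(1) unfolding N_def J_def by blast
  have BB': "v \<in> B' - S" if "v \<in> B - S" "v \<noteq> z" for v using that B'(2) by blast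
  \<comment> \<open>With the matching unchanged it suffices that the exponents grow only where the
    budget permits; this serves every case except the one with a new matching edge.\<close>
  have intro: "nice (insert z U) B S"
    if nz: "lookup (graph_poly r (inner_edges (insert z U) S - M)) \<theta> \<noteq> 0"
      and S0: "\<And>v. v \<in> S \<Longrightarrow> lookup \<theta> v = 0" and z2: "lookup \<theta> z \<le> 2"
      and N3: "\<And>v. v \<in> N - J - B \<Longrightarrow> lookup \<theta> v \<le> 3"
      and rest: "\<And>v. v \<noteq> z \<Longrightarrow> v \<notin> N - J - B \<Longrightarrow> lookup \<theta> v \<le> lookup \<eta> v" for \<theta>
  proof -
    have "lookup \<theta> v + (if v \<in> \<Union>M then 1 else 0) \<le> 2" if v: "v \<in> B - S" for v
    proof (cases "v = z")
      case True then show ?thesis using z2 zM by simp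
    next
      case False
      then show ?thesis using \<eta>B[OF BB'[OF v False]] rest[of v] v by auto
    qed
    moreover have "lookup \<theta> v \<le> 3" if "v \<in> insert z U" for v
      using that z2 N3[of v] rest[of v] \<eta>U[of v] by (cases "v = z"; cases "v \<in> N - J - B") auto
    ultimately have "nice_for (insert z U) B S M \<theta>"
      unfolding nice_for_def using mE nz S0 by (intro conjI ballI) (assumption | blast)+
    then show ?thesis unfolding nice_def by blast
  qed
  have val: "lookup (\<alpha> + star_exp z N J') v = lookup \<alpha> v + (if v = z then card J' else if v \<in> N - J' then 1 else 0)" for \<alpha> J' v
    using N by (simp add: lookup_add lookup_star_exp)
  have \<eta>N: "lookup \<eta> v \<le> 2" if "v \<in> N - J" for v using \<eta>B[OF NB'[OF that]] by (auto split: if_splits)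
  show ?thesis
  proof (cases "N \<inter> B - S = {}")
    case True
    have "card J \<le> 2" using good(1) card_mono[OF _ J(4)] finB by auto
    moreover have "lookup (graph_poly r (inner_edges (insert z U) S - M)) (\<eta> + star_exp z N J) \<noteq> 0"
      unfolding eq gp(1) by (rule star_mult_nonzero[OF N(2,3) J(1) gp(2)]) (use m J in auto)
    moreover have "v \<notin> N" if "v \<in> S" "v \<notin> J" for v using that unfolding J_def by blast
    moreover have "v \<notin> B" if "v \<in> N - J" for v using True that unfolding J_def by blast
    ultimately show ?thesis
      using S(2) \<eta>S \<eta>z \<eta>N by (intro intro[of "\<eta> + star_exp z N J"]) (auto simp: val)
  next
    case False
    then obtain w where w: "w \<in> N \<inter> B - S" by blast
    have "card (N \<inter> B - S) \<le> 1" using good(2) NB by simp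
    then have w_only: "N \<inter> B - S = {w}"
      using w finB by (metis card_le_Suc0_iff_eq One_nat_def finite_Diff finite_Int is_singletonI' is_singleton_the_elem singletonD empty_iff)
    have wJ: "w \<notin> J" "w \<noteq> z" "insert w J \<subseteq> N" using w J N unfolding J_def by auto
    have "insert w J \<subseteq> nbrs E z \<inter> B" using w J NB by auto
    then have "card (insert w J) \<le> 2" using good(1) card_mono[of "nbrs E z \<inter> B" "insert w J"] finB by auto
    then have cJ: "card J \<le> 1" "card (insert w J) \<le> 2" using wJ J(3) by auto
    have NJ: "v \<notin> B" if "v \<in> N - J" "v \<noteq> w" for v using w_only that unfolding J_def by blast
    have SJ: "v \<notin> N" "v \<noteq> w" if "v \<in> S" "v \<notin> J" for v using that w unfolding J_def by auto
    show ?thesis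
    proof (cases "lookup (graph_poly r (inner_edges U S - M) * graph_poly r (star z N)) (\<eta> + star_exp z N (insert w J)) = 0")
      case False
      then show ?thesis
        using S(2) \<eta>S \<eta>z \<eta>N cJ wJ NJ SJ J w
        by (intro intro[of "\<eta> + star_exp z N (insert w J)"]) (auto simp: val eq gp(1))
    next
      case True
      have P0: "lookup (graph_poly r (inner_edges U S - M)) \<eta> \<noteq> 0" using m by simp
      have J0: "lookup \<eta> u = 0" if "u \<in> J" for u using \<eta>S J(2) that by blast
      obtain i \<alpha> where i: "i \<in> N - insert w J" and \<alpha>: "lookup (graph_poly r (inner_edges U S - M)) \<alpha> \<noteq> 0"
        and \<alpha>\<eta>: "\<alpha> + Poly_Mapping.single w 1 = \<eta> + Poly_Mapping.single i 1"
        using star_mult_alternative[OF N(2,3) wJ(3,1) gp(2) P0 J0 True] by blast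
      have \<alpha>v: "lookup \<alpha> v + (if v = w then 1 else 0) = lookup \<eta> v + (if v = i then 1 else 0)" for v
        using arg_cong[OF \<alpha>\<eta>, of "\<lambda>x. lookup x v"] by (auto simp: lookup_add lookup_single when_def split: if_splits)
      have iw: "i \<noteq> w" "i \<noteq> z" "i \<in> N - J" "i \<notin> B" "i \<notin> S" using i N NJ S by auto
      have \<alpha>J: "lookup \<alpha> u = 0" if "u \<in> J" for u
        using \<alpha>v[of u] \<eta>S[of u] that J wJ iw by (auto split: if_splits)
      have \<alpha>': "lookup \<alpha> w + 1 = lookup \<eta> w" "lookup \<alpha> i = lookup \<eta> i + 1"
        "\<And>v. v \<noteq> w \<Longrightarrow> v \<noteq> i \<Longrightarrow> lookup \<alpha> v = lookup \<eta> v"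
        subgoal using \<alpha>v[of w] iw by simp
        subgoal using \<alpha>v[of i] iw by simp
        subgoal for v using \<alpha>v[of v] by simp
        done
      show ?thesis
      proof (cases "i \<in> \<Union>M")
        case True
        \<comment> \<open>A matched \<open>i\<close> has room for both the unit moved from
          \<open>w\<close> and the unit from the star. \<open>w\<close> pays for its edge to
          \<open>z\<close> and returns to its old exponent.\<close>
        then have "lookup \<eta> i \<le> 1" using \<eta>B[OF NB'[OF iw(3)]] by simp
        have "lookup (graph_poly r (inner_edges (insert z U) S - M)) (\<alpha> + star_exp z N J) \<noteq> 0"
          unfolding eq gp(1) by (rule star_mult_nonzero[OF N(2,3) J(1) gp(2) \<alpha> \<alpha>J])
        moreover have "lookup (\<alpha> + star_exp z N J) v \<le> lookup \<eta> v" if "v \<noteq> z" "v \<notin> N - J - B" for v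
        proof -
          have "v \<noteq> i" using that iw by blast
          then show ?thesis using that \<alpha>'(1) \<alpha>'(3)[of v] NJ[of v] by (cases "v = w") (auto simp: val)
        qed
        moreover have "lookup (\<alpha> + star_exp z N J) v \<le> 3" if "v \<in> N - J - B" for v
        proof (cases "v = i")
          case True
          then show ?thesis using \<open>lookup \<eta> i \<le> 1\<close> \<alpha>'(2) iw(2) by (simp add: val)
        next
          case False
          moreover have "v \<noteq> w" "v \<noteq> z" using that w N(3) by auto
          ultimately show ?thesis using \<alpha>'(3)[of v] \<eta>N[of v] that by (simp add: val)
        qed
        moreover have "lookup (\<alpha> + star_exp z N J) v = 0" if "v \<in> S" for v
          using that \<alpha>J \<alpha>'(3)[of v] \<eta>S[of v] SJ[of v] S(2) iw w by (cases "v \<in> J") (auto simp: val)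
        moreover have "lookup (\<alpha> + star_exp z N J) z \<le> 2"
          using \<alpha>'(3)[of z] wJ iw \<eta>z cJ by (simp add: val)
        ultimately show ?thesis by (intro intro) auto
      next
        case False
        \<comment> \<open>Matching z with \<open>i\<close> deletes their edge, so \<open>i\<close>
          gains only the moved unit and reaches at most 3; it lies outside \<open>B\<close>, where
          matching costs nothing. \<open>z\<close> pays only for \<open>J\<close>, at most one unit,
          and can afford to be matched.\<close>
        define N' where "N' = N - {i}"
        have N': "N' \<subseteq> U" "insert z N' \<subseteq> V" "z \<notin> N'" "J \<subseteq> N'" "finite N'"
          using N J iw unfolding N'_def by auto
        have zi: "{z, i} \<in> E" "i \<in> U" using i unfolding N_def nbrs_def by auto
        have zis: "{z, i} \<notin> inner_edges U S" using z(2) unfolding inner_edges_def by blast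
        have "star z N - {{z, i}} = star z N'" unfolding star_def N'_def using N(3) iw by (auto simp: doubleton_eq_iff)
        then have eq': "inner_edges (insert z U) S - insert {z, i} M = (inner_edges U S - M) \<union> star z N'"
          using eq zis by blast
        note gp' = graph_poly_inner_insert[OF z N'(1), of S M]
        define \<theta> where "\<theta> = \<alpha> + star_exp z N' J"
        have \<theta>: "lookup \<theta> v = lookup \<alpha> v + (if v = z then card J else if v \<in> N' - J then 1 else 0)" for v
          unfolding \<theta>_def using N' by (simp add: lookup_add lookup_star_exp)
        have nz: "lookup (graph_poly r (inner_edges (insert z U) S - insert {z, i} M)) \<theta> \<noteq> 0"
          unfolding eq' gp'(1) \<theta>_def by (rule star_mult_nonzero[OF N'(2-4) gp'(2) \<alpha> \<alpha>J])
        have \<theta>z: "lookup \<theta> z \<le> 1" using \<alpha>'(3)[of z] wJ iw \<eta>z cJ by (simp add: \<theta>)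
        have \<theta>i: "lookup \<theta> i \<le> 3" using \<alpha>'(2) \<eta>N[OF iw(3)] iw by (simp add: \<theta> N'_def)
        have \<theta>B: "lookup \<theta> v \<le> lookup \<eta> v" if "v \<noteq> z" "v \<noteq> i" "v \<notin> N - J - B" for v
          using that \<alpha>'(1) \<alpha>'(3)[of v] NJ[of v] by (cases "v = w") (auto simp: \<theta> N'_def)
        have \<theta>N: "lookup \<theta> v \<le> 3" if "v \<in> N - J - B" "v \<noteq> i" for v
        proof -
          have "v \<noteq> w" "v \<noteq> z" using that w N(3) by auto
          then show ?thesis using \<alpha>'(3)[of v] \<eta>N[of v] that by (simp add: \<theta> N'_def)
        qed
        have \<theta>S: "lookup \<theta> v = 0" if "v \<in> S" for v
          using that \<alpha>J \<alpha>'(3)[of v] \<eta>S[of v] SJ[of v] S(2) iw w by (cases "v \<in> J") (auto simp: \<theta> N'_def)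
        have cov: "lookup \<theta> v + (if v \<in> \<Union>(insert {z, i} M) then 1 else 0) \<le> 2" if v: "v \<in> B - S" for v
        proof (cases "v = z")
          case True then show ?thesis using \<theta>z by simp
        next
          case vz: False
          have "v \<noteq> i" using v iw by blast
          then have "lookup \<theta> v \<le> lookup \<eta> v" using \<theta>B[of v] v vz by blast
          then show ?thesis using \<eta>B[OF BB'[OF v vz]] vz \<open>v \<noteq> i\<close> by auto
        qed
        have le3: "lookup \<theta> v \<le> 3" if "v \<in> insert z U" for v
          using that \<theta>z \<theta>i \<theta>B[of v] \<theta>N[of v] \<eta>U[of v] by (cases "v = z"; cases "v = i"; cases "v \<in> N - J - B") auto
        have pd: "pairwise disjnt (insert {z, i} M)"
          using m zM False by (auto simp: pairwise_insert disjnt_def)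
        have eM: "\<forall>e\<in>insert {z, i} M. e \<subseteq> insert z U \<and> e \<inter> S = {}"
          using m zi S(2) iw by auto
        have insE: "insert {z, i} M \<subseteq> E" using mE(1) zi(1) by simp
        have "nice_for (insert z U) B S (insert {z, i} M) \<theta>"
          unfolding nice_for_def by (intro conjI insE pd eM nz ballI \<theta>S cov le3)
        then show ?thesis unfolding nice_def by blast
      qed
    qed
  qed
qed

text \<open>A clique meets at most one component of U - K, and there are at least two;
  \<open>D\<close> is a component avoiding \<open>S\<close>.\<close>

lemma separating_part:
  assumes K: "\<not> conn E (U - K)" and S: "\<And>x y. x \<in> S \<Longrightarrow> y \<in> S \<Longrightarrow> x \<noteq> y \<Longrightarrow> {x, y} \<in> E" "S \<subseteq> U"
  obtains D where "D \<noteq> {}" "D \<subset> U - K" "D \<inter> S = {}"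
    "\<And>u v. u \<in> D \<Longrightarrow> v \<in> U - K \<Longrightarrow> {u, v} \<in> E \<Longrightarrow> v \<in> D"
proof -
  obtain x y where xy: "x \<in> U - K" "y \<in> U - K" "y \<notin> component E (U - K) x"
    using K unfolding conn_def component_def by blast
  note sub = component_subset[OF xy(1), of E] component_subset[OF xy(2), of E]
  have "component E (U - K) x \<noteq> component E (U - K) y" using xy by (metis component_self)
  then have dis: "component E (U - K) x \<inter> component E (U - K) y = {}" by (rule component_disjoint)
  note result = that
  have main: thesis if a: "a \<in> U - K" "component E (U - K) a \<inter> S = {}" "component E (U - K) a \<noteq> U - K" for a
  proof (rule result[of "component E (U - K) a"])
    show "component E (U - K) a \<subset> U - K" using component_subset[OF a(1)] a(3) by blast
    show "component E (U - K) a \<noteq> {}" using component_self by fast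
    show "v \<in> component E (U - K) a" if "u \<in> component E (U - K) a" "v \<in> U - K" "{u, v} \<in> E" for u v
      using component_closed[OF that(1)] component_subset[OF a(1)] that by blast
  qed (rule a(2))
  show thesis
  proof (cases "component E (U - K) x \<inter> S = {}")
    case True
    moreover have "component E (U - K) x \<noteq> U - K" using xy(2,3) by metis
    ultimately show thesis by (rule main[OF xy(1)])
  next
    case False
    then obtain s where s: "s \<in> S" "s \<in> component E (U - K) x" by blast
    have "t \<in> component E (U - K) x" if "t \<in> S" "t \<in> U - K" for t
      using component_closed[OF s(2), of t] S(1)[of s t] s that sub by (cases "s = t") auto
    then have "component E (U - K) y \<inter> S = {}" using dis sub by blast
    moreover have "component E (U - K) y \<noteq> U - K" using dis xy(1) component_self[of x E "U - K"] by blast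
    ultimately show thesis by (rule main[OF xy(2)])
  qed
qed

section \<open>The induction on the number of remaining vertices\<close>

lemma boundary_insert_nbrs: "nbrs E z \<inter> U \<subseteq> boundary E U (insert z X)"
  unfolding boundary_def nbrs_def joined_def by (auto simp: insert_commute)

lemma boundary_shrink: "boundary E U X - {z} \<subseteq> boundary E (U - {z}) (insert z X)"
  unfolding boundary_def joined_def by auto

text \<open>The precoloured clique makes the induction compatible with cutting: a cut clique
  \<open>K\<close> becomes the precoloured set of the part cut off, while \<open>S\<close> stays in
  the other part. If no clique of at most two boundary vertices cuts \<open>U\<close>, the
  connectivity assumptions of \<open>good_vertex\<close> hold.\<close>

lemma nice_exists:
  assumes "U \<subseteq> V" "X \<subseteq> V" "U \<inter> X = {}" "conn E X" "S \<subseteq> boundary E U X" "card S \<le> 2"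
    "\<And>x y. x \<in> S \<Longrightarrow> y \<in> S \<Longrightarrow> x \<noteq> y \<Longrightarrow> {x, y} \<in> E"
  shows "nice U (boundary E U X) S"
  using assms
proof (induction "card U" arbitrary: U X S rule: less_induct)
  case less
  define B where "B = boundary E U X"
  note UX = less.prems(1-4) and clique = less.prems(7)
  have BU: "B \<subseteq> U" unfolding B_def boundary_def by blast
  have SB: "S \<subseteq> B" using less.prems(5) unfolding B_def .
  have finU: "finite U" using finite_subset[OF UX(1) fin] .
  have jX: "joined E {v} X" if "v \<in> B" for v using that unfolding B_def boundary_def by blast
  \<comment> \<open>The empty clique is included, so a disconnected \<open>U\<close> is split along
    it.\<close>
  define clq where "clq K \<longleftrightarrow> K \<subseteq> B \<and> card K \<le> 2 \<and> (\<forall>x\<in>K. \<forall>y\<in>K. x \<noteq> y \<longrightarrow> {x, y} \<in> E)" for K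
  consider "U = S" | K where "clq K" "\<not> conn E (U - K)" | "U \<noteq> S" "B = S"
    | "S \<noteq> B" "\<And>K. clq K \<Longrightarrow> conn E (U - K)"
    by blast
  then show ?case
  proof cases
    case 1
    then show ?thesis using nice_whole BU unfolding B_def by simp
  next
    case (2 K')
    then obtain K where 2: "K \<subseteq> B" "card K \<le> 2" "\<And>x y. x \<in> K \<Longrightarrow> y \<in> K \<Longrightarrow> x \<noteq> y \<Longrightarrow> {x, y} \<in> E" "\<not> conn E (U - K)"
      unfolding clq_def by blast
    have "S \<subseteq> U" using SB BU by blast
    then obtain D where D: "D \<noteq> {}" "D \<subset> U - K" "D \<inter> S = {}"
      "\<And>u v. u \<in> D \<Longrightarrow> v \<in> U - K \<Longrightarrow> {u, v} \<in> E \<Longrightarrow> v \<in> D"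
      using separating_part[OF 2(4), of S] clique by blast
    have KU: "K \<subseteq> U" using 2(1) BU by blast
    have bd: "boundary E A X = B \<inter> A" if "A \<subseteq> U" for A
      using that unfolding B_def boundary_def by blast
    have "card (U - D) < card U" using D(1,2) finU by (intro psubset_card_mono) auto
    then have n1: "nice (U - D) (boundary E (U - D) X) S"
      by (rule less.hyps) (use UX SB BU D bd[of "U - D"] less.prems(6) clique in auto)
    have "card (D \<union> K) < card U" using D(2) finU KU by (intro psubset_card_mono) auto
    then have n2: "nice (D \<union> K) (boundary E (D \<union> K) X) K"
    proof (rule less.hyps)
      show "D \<union> K \<subseteq> V" "(D \<union> K) \<inter> X = {}" using UX(1,3) KU D(2) by auto
      show "K \<subseteq> boundary E (D \<union> K) X" using bd[of "D \<union> K"] KU D(2) 2(1) by auto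
    qed (fact UX 2)+
    have cap: "(U - D) \<inter> (D \<union> K) = K" and cup: "(U - D) \<union> (D \<union> K) = U" using D(2) KU by blast+
    have "nice ((U - D) \<union> (D \<union> K)) B S"
    proof (rule nice_glue[OF n1])
      show "nice (D \<union> K) (boundary E (D \<union> K) X) ((U - D) \<inter> (D \<union> K))" using n2 cap by simp
      show "B \<inter> (U - D) \<subseteq> boundary E (U - D) X" "B \<inter> (D \<union> K) \<subseteq> boundary E (D \<union> K) X"
        using bd[of "U - D"] bd[of "D \<union> K"] D(2) KU by blast+
      show "e \<subseteq> U - D \<or> e \<subseteq> D \<union> K" if e: "e \<in> E" "e \<subseteq> (U - D) \<union> (D \<union> K)" for e
      proof -
        obtain x y where xy: "e = {x, y}" using edge_card[OF e(1)] by (metis card_2_iff)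
        then have "x \<in> U" "y \<in> U" "{x, y} \<in> E" "{y, x} \<in> E" using e cup by (auto simp: insert_commute)
        then show ?thesis using D(4)[of x y] D(4)[of y x] xy by blast
      qed
    qed (use SB BU D cup in blast)+
    then show ?thesis using cup unfolding B_def by simp
  next
    case 3
    obtain z where z: "z \<in> U" "z \<in> S \<or> S = {}" using 3 SB BU by blast
    define X' where "X' = (if S = {} then {z} else insert z X)"
    have "conn E X'"
      unfolding X'_def using conn_insert[OF UX(4) jX] z SB by auto
    moreover have "card (U - {z}) < card U" using card_Diff1_less[OF finU z(1)] .
    moreover have "card (S - {z}) \<le> 2" using less.prems(6) by (meson card_Diff1_le le_trans)
    moreover have "S - {z} \<subseteq> boundary E (U - {z}) X'"
      using boundary_shrink[of U X z] SB unfolding X'_def B_def by auto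
    moreover have "U - {z} \<subseteq> V" "X' \<subseteq> V" "(U - {z}) \<inter> X' = {}" using UX z unfolding X'_def by auto
    ultimately have "nice (U - {z}) (boundary E (U - {z}) X') (S - {z})"
      using less.hyps clique by (metis Diff_iff)
    moreover have "nbrs E z \<inter> (U - {z}) \<subseteq> boundary E (U - {z}) X'"
      unfolding X'_def using boundary_insert_nbrs by (cases "S = {}") auto
    ultimately have "nice (insert z (U - {z})) B S"
      using nice_insert_precoloured[of z "U - {z}" S B] z UX SB BU 3 by blast
    then show ?thesis using z unfolding B_def by (simp add: insert_absorb)
  next
    case 4
    \<comment> \<open>Stated for an arbitrary clique \<open>S'\<close>, because an empty
      \<open>S\<close> is replaced by an edge below.\<close>
    have remove_good: "nice U B S'"
      if S': "S' \<subseteq> B" "card S' \<le> 2" "\<And>x y. x \<in> S' \<Longrightarrow> y \<in> S' \<Longrightarrow> x \<noteq> y \<Longrightarrow> {x, y} \<in> E"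
        and z: "z \<in> B - S'" "card (nbrs E z \<inter> B) \<le> 2" "card (nbrs E z \<inter> B - S') \<le> 1" for S' z
    proof -
      have "z \<in> U" using z BU by blast
      have "conn E (insert z X)" using conn_insert[OF UX(4) jX] z by blast
      moreover have "card (U - {z}) < card U" using card_Diff1_less[OF finU \<open>z \<in> U\<close>] .
      moreover have "S' \<subseteq> boundary E (U - {z}) (insert z X)"
        using boundary_shrink[of U X z] S'(1) z(1) unfolding B_def by blast
      moreover have "U - {z} \<subseteq> V" "insert z X \<subseteq> V" "(U - {z}) \<inter> insert z X = {}" using UX \<open>z \<in> U\<close> by auto
      ultimately have n: "nice (U - {z}) (boundary E (U - {z}) (insert z X)) S'"
        using less.hyps S' by metis
      have "nice (insert z (U - {z})) B S'"
        by (rule nice_insert_good[OF _ _ _ S'(1) _ _ n boundary_insert_nbrs _ z(2,3)])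
          (use boundary_shrink[of U X z] z UX BU \<open>z \<in> U\<close> in \<open>auto simp: B_def\<close>)
      then show ?thesis using \<open>z \<in> U\<close> by (simp add: insert_absorb)
    qed
    have conn0: "conn E U" using 4(2)[of "{}"] by (simp add: clq_def)
    have conn1: "conn E (U - {x})" if "x \<in> B" for x using 4(2)[of "{x}"] that by (simp add: clq_def)
    have conn2: "conn E (U - {x, y})" if "x \<in> B" "y \<in> B" "{x, y} \<in> E" for x y
      using 4(2)[of "{x, y}"] that by (auto simp: clq_def insert_commute card_insert_if)
    have nonempty: "nice U B S'"
      if S': "S' \<subseteq> B" "card S' \<le> 2" "\<And>x y. x \<in> S' \<Longrightarrow> y \<in> S' \<Longrightarrow> x \<noteq> y \<Longrightarrow> {x, y} \<in> E" "S' \<noteq> {}" "S' \<noteq> B" for S'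
    proof -
      obtain z where "z \<in> B - S'" "card (nbrs E z \<inter> B) \<le> 2" "card (nbrs E z \<inter> B - S') \<le> 1"
        using good_vertex[OF UX conn0, of S'] conn1 conn2 S' unfolding B_def by blast
      then show ?thesis using remove_good[OF S'(1-3)] by blast
    qed
    show ?thesis
    proof (cases "S = {}")
      case False
      then show ?thesis using nonempty[OF SB less.prems(6) clique _ 4(1)] unfolding B_def by blast
    next
      case True
      \<comment> \<open>\<open>good_vertex\<close> needs a vertex of \<open>S\<close> as a link to
        \<open>X\<close>. For S = {}, either \<open>z\<close> is itself good, having at most one
        boundary neighbour, or a boundary edge at \<open>z\<close> is precoloured and released
        afterwards.\<close>
      then obtain z where z: "z \<in> B" using 4(1) by blast
      show ?thesis
      proof (cases "card (nbrs E z \<inter> B) \<le> 1")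
        case True
        then have "nice U B {}" using remove_good[of "{}" z] z by auto
        then show ?thesis using \<open>S = {}\<close> unfolding B_def by simp
      next
        case False
        then have two: "2 \<le> card (nbrs E z \<inter> B)" by simp
        then obtain a where a: "a \<in> nbrs E z \<inter> B" by (metis all_not_in_conv card.empty not_numeral_le_zero)
        have za: "{z, a} \<in> E" using a unfolding nbrs_def by simp
        \<comment> \<open>The second boundary neighbour of \<open>z\<close> lies outside the new
          precoloured edge, as \<open>good_vertex\<close> requires.\<close>
        have "B \<noteq> {z, a}"
        proof
          assume "B = {z, a}"
          then have "nbrs E z \<inter> B \<subseteq> {a}" unfolding nbrs_def using edge_neq by blast
          then have "card (nbrs E z \<inter> B) \<le> card {a}" by (intro card_mono) auto
          then show False using two by simp
        qed
        then have "nice U B {z, a}"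
          using z a za by (intro nonempty) (auto simp: insert_commute card_insert_if)
        then have "nice U B {}" using nice_forget_edge za z a BU by blast
        then show ?thesis using \<open>S = {}\<close> unfolding B_def by simp
      qed
    qed
  qed
qed

end

theorem theorem4:
  fixes V :: "'v set" and E :: "'v set set" and r :: "'v rel"
  assumes "planar_graph V E" and "linear_order_on V r"
  shows "\<exists>M. matching E M \<and> AT_number r V (E - M) \<le> 4"
proof -
  obtain p \<gamma> where "simple_graph V E" "plane_drawing V E p \<gamma>" using assms(1) unfolding planar_graph_def by blast
  then interpret ordered_drawing V E p \<gamma> r
    using assms(2) by unfold_locales (auto simp: simple_graph_def)
  have "boundary E V {} = {}" unfolding boundary_def joined_def by simp
  \<comment> \<open>With nothing removed the boundary is empty, so only the exponent bound 3
    remains.\<close>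
  then have "nice V {} {}" using nice_exists[of V "{}" "{}"] by simp
  then obtain M \<eta> where M: "nice_for V {} {} M \<eta>" unfolding nice_def by blast
  have "inner_edges V {} = E" unfolding inner_edges_def using edge_subset edge_card by fastforce
  then have nz: "lookup (graph_poly r (E - M)) \<eta> \<noteq> 0" using M unfolding nice_for_def by simp
  have "keys \<eta> \<subseteq> V" using nice_for_support[OF M] by (meson in_keys_iff subsetI)
  moreover have "\<forall>v\<in>V. lookup \<eta> v < 4" using M unfolding nice_for_def by (simp add: less_Suc_eq_le eval_nat_numeral)
  ultimately have "AT_number r V (E - M) \<le> 4"
    unfolding AT_number_def using nz by (intro Least_le) blast
  moreover have "matching E M" using M unfolding nice_for_def matching_def by simp
  ultimately show ?thesis by blast
qed

end
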